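(* Let $p$ be a positive prime integer and let $q\in\{3,5,7,11,13,17,19\}$. Let $\xi$ be a primitive root of unity of order $q$ and let $K=\mathbb{Q}(\xi)$ be the corresponding cyclotomic field. Let $p_1$ be a prime element of $\mathbb{Z}[\xi]$ with $p_1\mid p$, let $l$ be a positive integer, let $\alpha\in K^{*}$, and consider the $K_{p_1}$-algebra $A=\left(\frac{\alpha,\,p_1^{ql}}{K_{p_1},\xi}\right)$. Let $P$ be a prime ideal in the ring of integers of the field $L=K(\sqrt[q]{\alpha})$ lying above $p_1$. Then $p_1^{ql}\in N_{L_P/K_{p_1}}(L_P^{*})$.
   Context: $K_{p_1}$ denotes the completion of $K$ with respect to the $p_1$-adic valuation (the valuation attached to the prime ideal $p_1\mathbb{Z}[\xi]$), $L_P$ denotes the completion of $L$ at $P$, and $N_{L_P/K_{p_1}}$ is the norm map of the extension $K_{p_1}\subseteq L_P$. For a field $F$ whose characteristic does not divide $n$ and which contains a primitive $n$-th root of unity $\xi$, and for $a,b\in F^{*}$, the symbol algebra $\left(\frac{a,b}{F,\xi}\right)$ is the $F$-algebra generated by elements $x,y$ subject to $x^{n}=a$, $y^{n}=b$, $yx=\xi xy$; here $n=q$. *)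

theory Defs
  imports "HOL-Algebra.Algebra" "HOL-Algebra.Algebraic_Closure_Type"
    "HOL-Computational_Algebra.Polynomial"
begin

text \<open>
  Number fields are subfields of the complex numbers, and rings such as \<open>\<int>[\<xi>]\<close> are subrings of them.
\<close>

abbreviation CC :: "complex ring"
  where "CC \<equiv> ring_of_type_algebra"

abbreviation sub_CC :: "complex set \<Rightarrow> complex ring"
  where "sub_CC S \<equiv> CC \<lparr>carrier := S\<rparr>"

definition primitive_root_of_unity :: "nat \<Rightarrow> complex \<Rightarrow> bool"
  where "primitive_root_of_unity n \<xi> \<longleftrightarrow> n > 0 \<and> \<xi> ^ n = 1 \<and> (\<forall>k. 0 < k \<and> k < n \<longrightarrow> \<xi> ^ k \<noteq> 1)"

definition cyclotomic_field :: "complex \<Rightarrow> complex set"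
  where "cyclotomic_field \<xi> = generate_field CC {\<xi>}"

definition cyclotomic_ring :: "complex \<Rightarrow> complex set"
  where "cyclotomic_ring \<xi> = generate_ring CC {\<xi>}"

definition adjoin :: "complex set \<Rightarrow> complex \<Rightarrow> complex set"
  where "adjoin K \<beta> = generate_field CC (insert \<beta> K)"

definition ring_of_integers :: "complex set \<Rightarrow> complex set"
  where "ring_of_integers L = {x \<in> L. algebraic_int x}"


section \<open>The valuation attached to a prime ideal\<close>

text \<open>
  For a prime ideal \<open>P\<close> of a ring \<open>R\<close> with fraction field \<open>K\<close>, the valuation of a nonzero
  \<open>a \<in> R\<close> is the largest \<open>n\<close> with \<open>a \<in> P\<^sup>n\<close> (the exponent of \<open>P\<close> in the factorization of the
  ideal \<open>a R\<close> when \<open>R\<close> is Dedekind), and it is extended to \<open>K\<close> by \<open>v (a / b) = v a - v b\<close>.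
  Ideal powers are taken in the multiplicative monoid of \<^const>\<open>ideals_set\<close>.
\<close>

definition adic_ord :: "complex ring \<Rightarrow> complex set \<Rightarrow> complex \<Rightarrow> nat"
  where "adic_ord R P a = (GREATEST n::nat. a \<in> P [^]\<^bsub>ideals_set R\<^esub> n)"

definition adic_val :: "complex ring \<Rightarrow> complex set \<Rightarrow> complex \<Rightarrow> int"
  where "adic_val R P x =
    (THE k. \<exists>a \<in> carrier R - {0}. \<exists>b \<in> carrier R - {0}.
       x = a / b \<and> k = int (adic_ord R P a) - int (adic_ord R P b))"

text \<open>The relation \<open>v x \<ge> k\<close>, with the convention \<open>v 0 = \<infinity>\<close>.\<close>

definition adic_val_ge :: "complex ring \<Rightarrow> complex set \<Rightarrow> complex \<Rightarrow> int \<Rightarrow> bool"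
  where "adic_val_ge R P x k \<longleftrightarrow> x = 0 \<or> adic_val R P x \<ge> k"


section \<open>Completion\<close>

text \<open>
  The completion of a field \<open>K\<close> at the prime \<open>P\<close> of \<open>R\<close>: Cauchy sequences in \<open>K\<close> modulo null
  sequences.
\<close>

definition cauchy_ring :: "complex set \<Rightarrow> complex ring \<Rightarrow> complex set \<Rightarrow> (nat \<Rightarrow> complex) ring"
  where "cauchy_ring K R P =
    \<lparr>carrier = {s. range s \<subseteq> K \<and>
        (\<forall>k. \<exists>N. \<forall>m\<ge>N. \<forall>n\<ge>N. adic_val_ge R P (s m - s n) k)},
     monoid.mult = (\<lambda>s t n. s n * t n), monoid.one = (\<lambda>_. 1),
     ring.zero = (\<lambda>_. 0), ring.add = (\<lambda>s t n. s n + t n)\<rparr>"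

definition null_ideal :: "complex set \<Rightarrow> complex ring \<Rightarrow> complex set \<Rightarrow> (nat \<Rightarrow> complex) set"
  where "null_ideal K R P =
    {s \<in> carrier (cauchy_ring K R P). \<forall>k. \<exists>N. \<forall>n\<ge>N. adic_val_ge R P (s n) k}"

definition completion :: "complex set \<Rightarrow> complex ring \<Rightarrow> complex set \<Rightarrow> (nat \<Rightarrow> complex) set ring"
  where "completion K R P = cauchy_ring K R P Quot null_ideal K R P"

definition to_completion ::
    "complex set \<Rightarrow> complex ring \<Rightarrow> complex set \<Rightarrow> complex \<Rightarrow> (nat \<Rightarrow> complex) set"
  where "to_completion K R P x = null_ideal K R P +>\<^bsub>cauchy_ring K R P\<^esub> (\<lambda>_. x)"

text \<open>
  For \<open>K \<subseteq> L\<close> and \<open>P\<close> lying above a prime of \<open>K\<close>, an element of the completion of \<open>K\<close> is a coset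
  \<open>C\<close> of Cauchy sequences in \<open>K\<close>; these are Cauchy sequences in \<open>L\<close>, and adding the null ideal
  of \<open>L\<close> to \<open>C\<close> gives the corresponding coset in the completion of \<open>L\<close> at \<open>P\<close>.
\<close>

definition completion_embed ::
    "complex set \<Rightarrow> complex ring \<Rightarrow> complex set \<Rightarrow> (nat \<Rightarrow> complex) set \<Rightarrow> (nat \<Rightarrow> complex) set"
  where "completion_embed L R P C = set_add (cauchy_ring L R P) (null_ideal L R P) C"


section \<open>The norm of a finite field extension\<close>

definition ring_det :: "('a, 'b) ring_scheme \<Rightarrow> nat \<Rightarrow> (nat \<Rightarrow> nat \<Rightarrow> 'a) \<Rightarrow> 'a"
  where "ring_det R n M =
    (\<Oplus>\<^bsub>R\<^esub>\<pi> \<in> {\<pi>. \<pi> permutes {..<n}}.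
       (if evenperm \<pi> then \<one>\<^bsub>R\<^esub> else \<ominus>\<^bsub>R\<^esub> \<one>\<^bsub>R\<^esub>) \<otimes>\<^bsub>R\<^esub> (\<Otimes>\<^bsub>R\<^esub>i \<in> {..<n}. M i (\<pi> i)))"

definition is_basis :: "('a, 'b) ring_scheme \<Rightarrow> 'a set \<Rightarrow> 'a list \<Rightarrow> bool"
  where "is_basis E F Us \<longleftrightarrow> ring.independent E F Us \<and> ring.Span E F Us = carrier E"

definition coords :: "('a, 'b) ring_scheme \<Rightarrow> 'a set \<Rightarrow> 'a list \<Rightarrow> 'a \<Rightarrow> 'a list"
  where "coords E F Us v =
    (THE cs. length cs = length Us \<and> set cs \<subseteq> F \<and> ring.combine E cs Us = v)"

text \<open>
  The norm of \<open>x\<close> for a finite extension \<open>E\<close> of a subfield \<open>F\<close>: the determinant of the \<open>F\<close>-linear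
  map \<open>v \<mapsto> x v\<close> on \<open>E\<close>. It does not depend on the basis; one is chosen.
\<close>

definition field_norm :: "('a, 'b) ring_scheme \<Rightarrow> 'a set \<Rightarrow> 'a \<Rightarrow> 'a"
  where "field_norm E F x =
    (let Us = (SOME Us. is_basis E F Us)
     in ring_det E (length Us) (\<lambda>i j. coords E F Us (x \<otimes>\<^bsub>E\<^esub> (Us ! j)) ! i))"


section \<open>Symbol algebras\<close>

text \<open>The free associative algebra over \<open>F\<close> on an alphabet, as finitely supported functions on words.\<close>

definition free_algebra :: "('k, 'c) ring_scheme \<Rightarrow> ('k, 'g list \<Rightarrow> 'k) module"
  where "free_algebra F =
    \<lparr>carrier = {f. range f \<subseteq> carrier F \<and> finite {w. f w \<noteq> \<zero>\<^bsub>F\<^esub>}},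
     monoid.mult = (\<lambda>f g w. \<Oplus>\<^bsub>F\<^esub>k \<in> {..length w}. f (take k w) \<otimes>\<^bsub>F\<^esub> g (drop k w)),
     monoid.one = (\<lambda>w. if w = [] then \<one>\<^bsub>F\<^esub> else \<zero>\<^bsub>F\<^esub>),
     ring.zero = (\<lambda>_. \<zero>\<^bsub>F\<^esub>),
     ring.add = (\<lambda>f g w. f w \<oplus>\<^bsub>F\<^esub> g w),
     module.smult = (\<lambda>c f w. c \<otimes>\<^bsub>F\<^esub> f w)\<rparr>"

definition word :: "('k, 'c) ring_scheme \<Rightarrow> 'g list \<Rightarrow> 'g list \<Rightarrow> 'k"
  where "word F u = (\<lambda>w. if w = u then \<one>\<^bsub>F\<^esub> else \<zero>\<^bsub>F\<^esub>)"

definition quotient_algebra :: "('k, 'a) module \<Rightarrow> 'a set \<Rightarrow> ('k, 'a set) module"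
  where "quotient_algebra A I =
    \<lparr>carrier = carrier (A Quot I),
     monoid.mult = monoid.mult (A Quot I),
     monoid.one = monoid.one (A Quot I),
     ring.zero = ring.zero (A Quot I), ring.add = ring.add (A Quot I),
     module.smult = (\<lambda>c C. set_add A I ((\<lambda>x. c \<odot>\<^bsub>A\<^esub> x) ` C))\<rparr>"

datatype symbol_gen = GenX | GenY

definition symbol_relations ::
    "('k, 'c) ring_scheme \<Rightarrow> nat \<Rightarrow> 'k \<Rightarrow> 'k \<Rightarrow> 'k \<Rightarrow> (symbol_gen list \<Rightarrow> 'k) set"
  where "symbol_relations F n \<xi> a b =
    (let A = free_algebra F in
      {word F (replicate n GenX) \<ominus>\<^bsub>A\<^esub> (a \<odot>\<^bsub>A\<^esub> \<one>\<^bsub>A\<^esub>),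
       word F (replicate n GenY) \<ominus>\<^bsub>A\<^esub> (b \<odot>\<^bsub>A\<^esub> \<one>\<^bsub>A\<^esub>),
       word F [GenY, GenX] \<ominus>\<^bsub>A\<^esub> (\<xi> \<odot>\<^bsub>A\<^esub> word F [GenX, GenY])})"

text \<open>HOL-Algebra ideals are two-sided, so \<^const>\<open>genideal\<close> yields the two-sided ideal of relations.\<close>

definition symbol_algebra ::
    "('k, 'c) ring_scheme \<Rightarrow> nat \<Rightarrow> 'k \<Rightarrow> 'k \<Rightarrow> 'k \<Rightarrow> ('k, (symbol_gen list \<Rightarrow> 'k) set) module"
  where "symbol_algebra F n \<xi> a b =
    quotient_algebra (free_algebra F) (genideal (free_algebra F) (symbol_relations F n \<xi> a b))"

end

theory Submission
  imports Defs
begin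

text \<open>
  Write \<open>F\<close> for the image of \<open>K\<^bsub>p1\<^esub>\<close> in \<open>L\<^sub>P\<close> and \<open>b\<close> for the image of \<open>\<beta>\<close>. Finite dimensional subspaces
  over the complete field \<open>F\<close> are closed and \<open>L\<close> is dense in \<open>L\<^sub>P\<close>, so \<open>L\<^sub>P = F(b)\<close>. As \<open>F\<close> contains
  the \<open>q\<close>-th roots of unity and \<open>q\<close> is prime, \<open>d = [L\<^sub>P : F]\<close> is \<open>1\<close> or \<open>q\<close>. The norm of \<open>p1\<^sup>m\<close> is
  \<open>p1\<^bsup>dm\<^esup>\<close>, and \<open>m = q l / d\<close> does the job.

  The adic valuation of \<open>L\<close> at \<open>P\<close> is a valuation because the localization at \<open>P\<close> has a uniformizer.
  Only the residue ring modulo \<open>p\<close> is needed for this: it is finite because a family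
  independent modulo \<open>p\<close> is independent over the rationals.
\<close>

section \<open>Polynomials, radical extensions and norms\<close>

text \<open>The local degree is not determined by [L : K]: \<alpha> may become a q-th power in the
  completion. This forces both cases d = 1 and d = q, and the exponent q l is divisible by either.

  For the uniformizer the task is to find y in L with y P inside S but not inside P, where S is the
  ring of integers of L. Because S / p S is finite, every element of P becomes nilpotent in its
  localization at P, so some b in S survives in that localization although b P lies in p S. Then y =
  b / p works, and any \<pi> in P with y \<pi> outside P generates P locally. In Z[\<xi>] the prime
  is principal, and p1 itself is the uniformizer.

  The localization is never formed. Its elements are handled through identities t x = \<pi>^n y with
  t outside P, which give the order at P directly and make it additive.

  Restricted to K, the valuation at P is a positive multiple of the one at p1. Hence Cauchy and null
  sequences in K mean the same for both, and K_p1 embeds in L_P.\<close>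

lemma CC_simps:
  "carrier CC = UNIV" "x \<otimes>\<^bsub>CC\<^esub> y = x * y" "x \<oplus>\<^bsub>CC\<^esub> y = x + y" "\<one>\<^bsub>CC\<^esub> = 1" "\<zero>\<^bsub>CC\<^esub> = 0" "\<ominus>\<^bsub>CC\<^esub> x = - x"
proof -
  interpret CC: field CC by (rule field_from_type_algebra)
  show "\<ominus>\<^bsub>CC\<^esub> x = - x"
    by (rule CC.minus_equality) (auto simp: ring_of_type_algebra_def)
qed (simp_all add: ring_of_type_algebra_def)

lemma CC_inv: "x \<noteq> 0 \<Longrightarrow> inv\<^bsub>CC\<^esub> x = inverse x"
proof -
  interpret CC: field CC by (rule field_from_type_algebra)
  show "x \<noteq> 0 \<Longrightarrow> inv\<^bsub>CC\<^esub> x = inverse x"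
    by (intro CC.comm_inv_char) (auto simp: ring_of_type_algebra_def)
qed

lemma CC_pow: "x [^]\<^bsub>CC\<^esub> (n::nat) = x ^ n"
proof -
  interpret CC: field CC by (rule field_from_type_algebra)
  show ?thesis by (induction n) (simp_all add: CC_simps)
qed

section \<open>Degrees of radical extensions in the presence of roots of unity\<close>

lemma (in field) card_roots_le_degree:
  assumes p: "p \<in> carrier (poly_ring R)" "p \<noteq> []"
    and A: "A \<subseteq> carrier R" "\<And>x. x \<in> A \<Longrightarrow> eval p x = \<zero>"
  shows "card A \<le> Polynomials.degree p"
proof -
  have "A \<subseteq> set_mset (roots p)"
    using A p roots_mem_iff_is_root[OF p(1)] unfolding is_root_def by auto
  then have "card A \<le> card (set_mset (roots p))"
    by (intro card_mono) auto
  also have "\<dots> \<le> size (roots p)"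
    by (metis card_eq_sum mset_set_set_mset_msubset size_mset_mono size_mset_set size_multiset_overloaded_eq)
  finally show ?thesis using size_roots_le_degree[OF p(1)] by simp
qed

lemma (in domain) nat_pow_nonzero:
  "x \<in> carrier R \<Longrightarrow> x \<noteq> \<zero> \<Longrightarrow> x [^] (n::nat) \<noteq> \<zero>"
  by (induction n) (auto simp: integral_iff)

text \<open>The substitution p(c X). Coefficient lists begin with the leading coefficient, so the
  length of the tail is the exponent belonging to the head.\<close>

fun (in ring) scale_poly :: "'a \<Rightarrow> 'a list \<Rightarrow> 'a list" where
  "scale_poly c [] = []"
| "scale_poly c (a # p) = (a \<otimes> c [^] length p) # scale_poly c p"

lemma (in cring) eval_scale_poly:
  assumes "c \<in> carrier R" "x \<in> carrier R" "set p \<subseteq> carrier R"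
  shows "eval (scale_poly c p) x = eval p (c \<otimes> x)"
proof -
  have len: "length (scale_poly c p) = length p" for p by (induction p) auto
  show ?thesis using assms(3)
    by (induction p) (use assms in \<open>auto simp: len nat_pow_distrib m_assoc\<close>)
qed

text \<open>A nonzero c keeps the leading coefficient nonzero, which is what makes the list a
  normalized polynomial.\<close>

lemma (in field) scale_poly_closed:
  assumes F: "subfield F R" and "c \<in> F" "c \<noteq> \<zero>" and p: "p \<in> carrier (F[X])"
  shows "scale_poly c p \<in> carrier (F[X])"
proof -
  note sr = subringE[OF subfieldE(1)[OF F]]
  have pw: "c [^] (n::nat) \<in> F" for n using sr assms(2) by (induction n) auto
  have c: "c \<in> carrier R" using assms(2) sr by auto
  have set: "set (scale_poly c p) \<subseteq> F" if "set p \<subseteq> F" for p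
    using that by (induction p) (auto intro!: sr(6) pw)
  show ?thesis
  proof (cases p)
    case Nil then show ?thesis by (simp add: univ_poly_def polynomial_def)
  next
    case (Cons a p')
    have "polynomial F p" using p by (simp add: univ_poly_carrier)
    then have a: "set p \<subseteq> F" "a \<noteq> \<zero>" using Cons by (auto simp: polynomial_def)
    then have "a \<otimes> c [^] length p' \<noteq> \<zero>"
      using c assms(3) sr(1) Cons integral_iff nat_pow_closed by (auto simp: nat_pow_nonzero)
    then have "polynomial F (scale_poly c p)"
      using set[OF a(1)] Cons by (auto simp: polynomial_def)
    then show ?thesis by (simp add: univ_poly_carrier)
  qed
qed

lemma (in field) root_of_unity_pow_eq_one_iff:
  assumes "q > 0" and z: "z \<in> carrier R" "z [^] q = \<one>" "\<And>k::nat. 0 < k \<Longrightarrow> k < q \<Longrightarrow> z [^] k \<noteq> \<one>"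
  shows "z [^] (m::nat) = \<one> \<longleftrightarrow> q dvd m"
proof -
  have "z [^] m = z [^] (q * (m div q) + m mod q)" by simp
  also have "\<dots> = (z [^] q) [^] (m div q) \<otimes> z [^] (m mod q)"
    using z(1) by (simp add: nat_pow_mult nat_pow_pow del: mult_div_mod_eq)
  also have "\<dots> = z [^] (m mod q)" using z by simp
  finally have *: "z [^] m = z [^] (m mod q)" .
  show ?thesis
    using z(3)[of "m mod q"] \<open>q > 0\<close> by (cases "m mod q = 0") (auto simp: * dvd_eq_mod_eq_0)
qed

text \<open>For j coprime to q the power z^j again has order q, so its powers with exponents below q
  are distinct, and multiplication by b is injective.\<close>

lemma (in field) card_root_of_unity_orbit:
  assumes z: "z \<in> carrier R" "z [^] q = \<one>" "\<And>k::nat. 0 < k \<Longrightarrow> k < q \<Longrightarrow> z [^] k \<noteq> \<one>"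
    and b: "b \<in> carrier R" "b \<noteq> \<zero>" and j: "coprime j q"
    and N: "N \<subseteq> {..<q}"
  shows "card ((\<lambda>k. (z [^] j) [^] k \<otimes> b) ` N) = card N"
proof (rule card_image, rule inj_onI)
  have le: "k = l" if "k \<in> N" "l \<in> N" "k \<le> l" "(z [^] j) [^] k \<otimes> b = (z [^] j) [^] l \<otimes> b" for k l
  proof -
    \<comment> \<open>An element of \<open>N\<close> lies below q, so q is positive, and 0 is not a
      q-th root of 1.\<close>
    have zz: "z \<noteq> \<zero>"
      using z N that one_not_zero nat_pow_zero[of q] by auto
    have "(z [^] j) [^] k = (z [^] j) [^] l"
      using that b z by (metis m_rcancel nat_pow_closed)
    also have "\<dots> = (z [^] j) [^] k \<otimes> (z [^] j) [^] (l - k)"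
      using that z by (simp add: nat_pow_mult)
    finally have "(z [^] j) [^] (l - k) = \<one>"
      using z zz by (metis m_lcancel nat_pow_closed nat_pow_nonzero one_closed r_one)
    then have "z [^] (j * (l - k)) = \<one>" using z by (simp add: nat_pow_pow)
    then have "q dvd j * (l - k)" using root_of_unity_pow_eq_one_iff[OF _ z] that N by fastforce
    then have "q dvd l - k" using j by (simp add: coprime_commute coprime_dvd_mult_right_iff)
    moreover have "l - k < q" using that N by auto
    ultimately show "k = l" using that by (auto dest: nat_dvd_not_less)
  qed
  fix k l assume "k \<in> N" "l \<in> N" "(z [^] j) [^] k \<otimes> b = (z [^] j) [^] l \<otimes> b"
  then show "k = l" using le[of k l] le[of l k] by (cases "k \<le> l") auto
qed

lemma (in ring) eval_binomial:
  assumes "x \<in> carrier R" "a \<in> carrier R" "n > 0"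
  shows "eval (\<one> # replicate (n - 1) \<zero> @ [\<ominus> a]) x = x [^] n \<ominus> a"
proof -
  have "eval (replicate (n - 1) \<zero> @ [\<ominus> a]) x = eval [\<ominus> a] x"
    using assms by (intro eval_replicate) auto
  then show ?thesis using assms by (simp add: a_minus_def)
qed

lemma (in domain) algebraic_if_pow_mem:
  assumes F: "subfield F R" and b: "b \<in> carrier R" "b [^] n \<in> F" and n: "n > (0::nat)"
  shows "(algebraic over F) b"
proof (rule algebraicI)
  let ?h = "\<one> # replicate (n - 1) \<zero> @ [\<ominus> (b [^] n)]"
  show "?h \<in> carrier (F[X])"
    using subringE[OF subfieldE(1)[OF F]] b by (auto simp: univ_poly_def polynomial_def)
  show "eval ?h b = \<zero>" using eval_binomial[OF b(1), of "b [^] n" n] b n by simp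
qed simp

text \<open>Write X^q - b^q = f g with f the minimal polynomial of b; every z^j b is a root of f or
  of g. If f has a second root z^j b with 0 < j < q, its root set turns out to be stable under
  multiplication by z^j, which has order q because q is prime, so f has q roots. Otherwise g has q -
  1 roots and f is linear.\<close>

theorem (in field) degree_Irr_Kummer:
  assumes F: "subfield F R" and b: "b \<in> carrier R" "b \<noteq> \<zero>" "b [^] q \<in> F"
    and q: "Factorial_Ring.prime (q::nat)"
    and z: "z \<in> F" "z [^] q = \<one>" "\<And>k::nat. 0 < k \<Longrightarrow> k < q \<Longrightarrow> z [^] k \<noteq> \<one>"
  shows "Polynomials.degree (Irr F b) = 1 \<or> Polynomials.degree (Irr F b) = q"
proof -
  note sr = subringE[OF subfieldE(1)[OF F]]
  have q0: "q > 0" using q prime_gt_0_nat by auto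
  have zc: "z \<in> carrier R" using z sr by auto
  have FX: "carrier (F[X]) \<subseteq> carrier (poly_ring R)"
    using sr(1) by (auto simp: univ_poly_def polynomial_def)
  define h where "h = \<one> # replicate (q - 1) \<zero> @ [\<ominus> (b [^] q)]"
  have hF: "h \<in> carrier (F[X])"
    using sr b by (auto simp: h_def univ_poly_def polynomial_def)
  have len_h: "Polynomials.degree h = q" using q0 by (simp add: h_def)
  have eval_h: "eval h x = x [^] q \<ominus> b [^] q" if "x \<in> carrier R" for x
    unfolding h_def using eval_binomial[OF that, of "b [^] q" q] b q0 by simp
  have hb: "eval h b = \<zero>" using eval_h[OF b(1)] b by (simp add: r_right_minus_eq)
  have alg: "(algebraic over F) b" using algebraic_if_pow_mem[OF F b(1,3) q0] .
  define f where "f = Irr F b"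
  note f = IrrE[OF F b(1) alg, folded f_def]
  interpret UP: domain "F[X]" using univ_poly_is_domain[OF subfieldE(1)[OF F]] .
  have f0: "f \<noteq> []"
    using f(2) by (auto simp: ring_irreducible_def univ_poly_zero)
  have fset: "set f \<subseteq> carrier R"
    using f(1) FX by (auto simp: univ_poly_def polynomial_def)
  have deg1: "Polynomials.degree f \<ge> 1"
    using pirreducible_degree[OF F f(1,2)] .
  have "f pdivides h" unfolding f_def using Irr_minimal[OF F b(1) alg hF hb] .
  then have "f divides\<^bsub>F[X]\<^esub> h"
    using pdivides_iff_shell[OF F f(1) hF] by simp
  then obtain g where g: "g \<in> carrier (F[X])" "h = f \<otimes>\<^bsub>F[X]\<^esub> g"
    by (auto simp: factor_def)
  have g0: "g \<noteq> []"
  proof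
    assume "g = []"
    then have "h = []" using g f(1) UP.r_null[OF f(1)] by (simp add: univ_poly_zero)
    then show False by (simp add: h_def)
  qed
  have degs: "Polynomials.degree f + Polynomials.degree g = q"
    using poly_mult_degree_eq[OF subfieldE(1)[OF F], of f g] f(1) f0 g g0 len_h
    by (auto simp: univ_poly_carrier univ_poly_mult)
  have root: "eval f (z [^] (j::nat) \<otimes> b) = \<zero> \<or> eval g (z [^] j \<otimes> b) = \<zero>" for j
  proof -
    have x: "z [^] j \<otimes> b \<in> carrier R" using zc b by auto
    have "(z [^] j) [^] q = (z [^] q) [^] j" using zc by (simp add: nat_pow_pow mult.commute)
    then have "(z [^] j \<otimes> b) [^] q = b [^] q"
      using zc b z(2) by (simp add: nat_pow_distrib)
    then have "eval h (z [^] j \<otimes> b) = \<zero>" using eval_h[OF x] b by (simp add: r_right_minus_eq)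
    then have "eval f (z [^] j \<otimes> b) \<otimes> eval g (z [^] j \<otimes> b) = \<zero>"
      using ring_hom_memE(2)[OF eval_is_hom[OF subfieldE(1)[OF F] x] f(1) g(1)] g(2) by simp
    then show ?thesis
      using ring_hom_memE(1)[OF eval_is_hom[OF subfieldE(1)[OF F] x]] f(1) g(1) integral by blast
  qed
  show "Polynomials.degree (Irr F b) = 1 \<or> Polynomials.degree (Irr F b) = q"
  proof (cases "\<exists>j. 0 < j \<and> j < q \<and> eval f (z [^] (j::nat) \<otimes> b) = \<zero>")
    case True
    then obtain j where j: "0 < j" "j < q" "eval f (z [^] j \<otimes> b) = \<zero>" by auto
    have cop: "coprime j q"
      using j q by (metis coprime_commute nat_dvd_not_less prime_imp_coprime_nat)
    define e where "e = z [^] j"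
    have eF: "e \<in> F" unfolding e_def using z(1) sr by (induction j) auto
    have ec: "e \<in> carrier R" using eF sr by auto
    have e0: "e \<noteq> \<zero>"
    proof
      assume "e = \<zero>"
      then have "e [^] q = \<zero>" using q0 by (simp add: nat_pow_zero)
      moreover have "e [^] q = (z [^] q) [^] j" using zc by (simp add: e_def nat_pow_pow mult.commute)
      ultimately show False using z(2) by simp
    qed
    \<comment> \<open>The polynomial f(e X) vanishes at b, so f divides it: multiplication by e
      sends roots of f to roots of f.\<close>
    have fs: "scale_poly e f \<in> carrier (F[X])"
      using scale_poly_closed[OF F eF e0 f(1)] .
    have "eval (scale_poly e f) b = \<zero>"
      using eval_scale_poly[OF ec b(1) fset] j by (simp add: e_def)
    then have dvd: "f pdivides scale_poly e f"
      using Irr_minimal[OF F b(1) alg fs] by (simp add: f_def)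
    have step: "eval f (e \<otimes> r) = \<zero>" if "eval f r = \<zero>" "r \<in> carrier R" for r
      using pdivides_imp_root_sharing[OF _ dvd that(2) that(1)] f(1) FX
        eval_scale_poly[OF ec that(2) fset] by auto
    have all: "eval f (e [^] (k::nat) \<otimes> b) = \<zero>" for k
    proof (induction k)
      case 0 then show ?case using f(4) b by simp
    next
      case (Suc k)
      have "e [^] Suc k \<otimes> b = e \<otimes> (e [^] k \<otimes> b)" using ec b
        by (simp add: m_assoc m_lcomm)
      then show ?case using step[OF Suc] ec b by simp
    qed
    have "card ((\<lambda>k. e [^] k \<otimes> b) ` {..<q}) \<le> Polynomials.degree f"
      using all f(1) FX f0 ec b by (intro card_roots_le_degree) auto
    also have "card ((\<lambda>k. e [^] k \<otimes> b) ` {..<q}) = q"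
      unfolding e_def using card_root_of_unity_orbit[OF zc z(2,3) b(1,2) cop, of "{..<q}"] by simp
    finally show ?thesis using degs by (auto simp: f_def)
  next
    case False
    then have "eval g (z [^] (j::nat) \<otimes> b) = \<zero>" if "j \<in> {0<..<q}" for j using that root[of j] by auto
    \<comment> \<open>The exponent 1 only brings the points z^k b into the shape of
      \<open>card_root_of_unity_orbit\<close>.\<close>
    then have "card ((\<lambda>k. (z [^] (1::nat)) [^] k \<otimes> b) ` {0<..<q}) \<le> Polynomials.degree g"
      using g(1) FX g0 zc b by (intro card_roots_le_degree) auto
    moreover have "card ((\<lambda>k. (z [^] (1::nat)) [^] k \<otimes> b) ` {0<..<q}) = q - 1"
      by (subst card_root_of_unity_orbit[OF zc z(2,3) b(1,2)]) auto
    ultimately have "q - 1 \<le> Polynomials.degree g" by simp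
    then have "Polynomials.degree f = 1" using degs deg1 by linarith
    then show ?thesis unfolding f_def ..
  qed
qed

section \<open>Determinants of scalar matrices and norms of elements of the base field\<close>

lemma (in cring) ring_det_diagonal:
  assumes c: "c \<in> carrier R"
  shows "ring_det R n (\<lambda>i j. if i = j then c else \<zero>) = c [^] n"
proof -
  let ?M = "\<lambda>i j. if i = j then c else \<zero>"
  let ?t = "\<lambda>\<pi>. (if evenperm \<pi> then \<one> else \<ominus> \<one>) \<otimes> (\<Otimes>i \<in> {..<n}. ?M i (\<pi> i))"
  have "ring_det R n ?M = (\<Oplus>\<pi> \<in> {\<pi>. \<pi> permutes {..<n}}. if \<pi> = id then c [^] n else \<zero>)"
    unfolding ring_det_def
  proof (intro add.finprod_cong' refl)
    fix \<pi> assume "\<pi> \<in> {\<pi>. \<pi> permutes {..<n}}"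
    then have p: "\<pi> permutes {..<n}" by simp
    show "?t \<pi> = (if \<pi> = id then c [^] n else \<zero>)"
    proof (cases "\<pi> = id")
      case True
      then show ?thesis using c finprod_const[of c "{..<n}"] by (simp add: evenperm_id)
    next
      case False
      then obtain i where i: "\<pi> i \<noteq> i" by fastforce
      then have "i < n" using p by (auto simp: permutes_def)
      \<comment> \<open>A moved index i contributes an off-diagonal entry, a zero factor.\<close>
      have "(\<Otimes>k \<in> {..<n}. ?M k (\<pi> k)) = ?M i (\<pi> i) \<otimes> (\<Otimes>k \<in> {..<n} - {i}. ?M k (\<pi> k))"
        using c \<open>i < n\<close> by (subst finprod_insert[symmetric]) (auto simp: insert_absorb insert_Diff)
      also have "\<dots> = \<zero>" using i c by (auto intro!: l_null finprod_closed)
      finally show ?thesis using False by simp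
    qed
  qed (use c in auto)
  also have "\<dots> = c [^] n"
  proof -
    have fin: "finite {\<pi>. \<pi> permutes {..<n}}" by (simp add: finite_permutations)
    have "id \<in> {\<pi>. \<pi> permutes {..<n}}" by (simp add: permutes_id)
    then show ?thesis
      using add.finprod_singleton[of id "{\<pi>. \<pi> permutes {..<n}}" "\<lambda>_. c [^] n"] fin c
      by (simp add: eq_commute[of _ id])
  qed
  finally show ?thesis .
qed

lemma (in ring) combine_unit_coords:
  assumes "set Us \<subseteq> carrier R" "c \<in> carrier R" "j < length Us"
  shows "combine ((replicate (length Us) \<zero>)[j := c]) Us = c \<otimes> Us ! j"
  using assms
proof (induction Us arbitrary: j)
  case (Cons u Us)
  have "combine (replicate (length Us) \<zero>) Us = \<zero>"
    using Cons.prems combine_replicate by auto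
  moreover have "c \<otimes> Us ! k \<in> carrier R" if "k < length Us" for k
    using that Cons.prems nth_mem by (intro m_closed) auto
  ultimately show ?case using Cons by (cases j) auto
qed simp

text \<open>Multiplication by c in \<open>F\<close> is a scalar map, so its matrix is c times the
  identity in whichever basis the choice operator returns, and all bases have length d.\<close>

theorem (in field) field_norm_base:
  assumes F: "subfield F R" and d: "dimension d F (carrier R)" and c: "c \<in> F"
  shows "field_norm R F c = c [^] d"
proof -
  note sr = subringE[OF subfieldE(1)[OF F]]
  obtain Vs where "set Vs \<subseteq> carrier R" "independent F Vs" "length Vs = d" "Span F Vs = carrier R"
    using exists_base[OF F d] by auto
  then have "is_basis R F Vs" by (simp add: is_basis_def)
  define Us where "Us = (SOME Us. is_basis R F Us)"
  have "is_basis R F Us" unfolding Us_def by (rule someI) fact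
  then have Us: "independent F Us" "Span F Us = carrier R" by (auto simp: is_basis_def)
  have Us_carr: "set Us \<subseteq> carrier R" using Us(1) independent_in_carrier by auto
  have len: "length Us = d"
    using dimension_independent[OF Us(1)] Us(2) dimension_is_inj[OF F _ d] by auto
  have cc: "c \<in> carrier R" using c sr by auto
  have coords: "coords R F Us (c \<otimes> Us ! j) = (replicate d \<zero>)[j := c]" if "j < d" for j
    unfolding coords_def
  proof (rule the_equality)
    let ?e = "(replicate d \<zero>)[j := c]"
    have e: "length ?e = length Us" "set ?e \<subseteq> F" "combine ?e Us = c \<otimes> Us ! j"
      using combine_unit_coords[OF Us_carr cc, of j] len that c sr set_update_subset_insert[of "replicate d \<zero>" j c]
      by auto
    then show "length ?e = length Us \<and> set ?e \<subseteq> F \<and> combine ?e Us = c \<otimes> Us ! j" by blast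
    fix cs assume cs: "length cs = length Us \<and> set cs \<subseteq> F \<and> combine cs Us = c \<otimes> Us ! j"
    have "c \<otimes> Us ! j \<in> Span F Us"
      unfolding Us(2) using cc Us_carr that len nth_mem by (intro m_closed) auto
    from unique_decomposition[OF F Us(1) this]
    show "cs = ?e" using cs e by auto
  qed
  have "field_norm R F c = ring_det R d (\<lambda>i j. coords R F Us (c \<otimes> Us ! j) ! i)"
    by (simp add: field_norm_def Us_def[symmetric] len)
  also have "\<dots> = ring_det R d (\<lambda>i j. if i = j then c else \<zero>)"
    unfolding ring_det_def
  proof (intro add.finprod_cong' refl)
    fix \<pi> assume "\<pi> \<in> {\<pi>. \<pi> permutes {..<d}}"
    then have p: "\<pi> permutes {..<d}" by simp
    have "(\<Otimes>i \<in> {..<d}. coords R F Us (c \<otimes> Us ! \<pi> i) ! i) = (\<Otimes>i \<in> {..<d}. if i = \<pi> i then c else \<zero>)"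
    proof (intro finprod_cong' refl)
      fix i assume "i \<in> {..<d}"
      then have "i < d" "\<pi> i < d" using permutes_in_image[OF p, of i] by auto
      then show "coords R F Us (c \<otimes> Us ! \<pi> i) ! i = (if i = \<pi> i then c else \<zero>)"
        by (auto simp: coords nth_list_update)
    qed (use cc in auto)
    then show "(if evenperm \<pi> then \<one> else \<ominus> \<one>) \<otimes> (\<Otimes>i \<in> {..<d}. coords R F Us (c \<otimes> Us ! \<pi> i) ! i)
      = (if evenperm \<pi> then \<one> else \<ominus> \<one>) \<otimes> (\<Otimes>i \<in> {..<d}. if i = \<pi> i then c else \<zero>)" by simp
  qed (use cc in auto)
  also have "\<dots> = c [^] d" by (rule ring_det_diagonal[OF cc])
  finally show ?thesis .
qed

section \<open>Subspaces of a nonarchimedean field\<close>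

text \<open>Read \<open>vg x k\<close> as v(x) >= k. With a relation, zero needs no infinite value.
  In \<open>vg_scale\<close> the integer w plays the role of v(x); this is the only link with
  multiplication.\<close>

locale nonarch_field = field R for R :: "('a, 'b) ring_scheme" (structure) +
  fixes vg :: "'a \<Rightarrow> int \<Rightarrow> bool"
  assumes vg_one: "vg \<one> 0"
    and vg_add: "\<lbrakk>x \<in> carrier R; y \<in> carrier R; vg x k; vg y k\<rbrakk> \<Longrightarrow> vg (x \<oplus> y) k"
    and vg_minus: "\<lbrakk>x \<in> carrier R; vg x k\<rbrakk> \<Longrightarrow> vg (\<ominus> x) k"
    and vg_mono: "\<lbrakk>x \<in> carrier R; vg x k; j \<le> k\<rbrakk> \<Longrightarrow> vg x j"
    and vg_separated: "\<lbrakk>x \<in> carrier R; \<And>k. vg x k\<rbrakk> \<Longrightarrow> x = \<zero>"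
    and vg_zero: "vg \<zero> k"
    and vg_scale: "\<lbrakk>x \<in> carrier R; x \<noteq> \<zero>\<rbrakk> \<Longrightarrow>
      \<exists>w. \<forall>y \<in> carrier R. \<forall>k. vg (x \<otimes> y) (k + w) \<longleftrightarrow> vg y k"
begin

definition vclosed :: "'a set \<Rightarrow> bool" where
  "vclosed W \<longleftrightarrow> (\<forall>x \<in> carrier R. (\<forall>k::nat. \<exists>w \<in> W. vg (x \<ominus> w) (int k)) \<longrightarrow> x \<in> W)"

text \<open>Limits are demanded only for sequences with a prescribed rate of convergence, up to an
  offset n. The coefficient sequences in \<open>vclosed_line_extension\<close> have exactly this
  shape, with n measuring how far y stays away from \<open>W\<close>.\<close>

definition vcomplete :: "'a set \<Rightarrow> bool" where
  "vcomplete F \<longleftrightarrow> (\<forall>c n. (\<forall>k::nat. c k \<in> F) \<and>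
      (\<forall>j k. j \<le> k \<longrightarrow> vg (c k \<ominus> c j) (int j - int n)) \<longrightarrow>
      (\<exists>l \<in> F. \<forall>k. vg (l \<ominus> c k) (int k - int n)))"

lemma vclosed_zero: "vclosed {\<zero>}"
  unfolding vclosed_def
proof (intro ballI impI)
  fix x assume x: "x \<in> carrier R" and *: "\<forall>k::nat. \<exists>w\<in>{\<zero>}. vg (x \<ominus> w) (int k)"
  have "vg x k" for k
  proof -
    have "vg x (int (nat k))" using *[rule_format, of "nat k"] x by (simp add: a_minus_def del: int_nat_eq)
    then show ?thesis using vg_mono[OF x, of "int (nat k)" k] by linarith
  qed
  then show "x \<in> {\<zero>}" using vg_separated[OF x] by simp
qed

text \<open>If y is not in the closed set \<open>W\<close>, no element of \<open>W\<close> comes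
  within order n of y. Let c_k y + w_k approximate x. Were c_k - c_j large while the approximations
  are close, dividing by it would bring y too close to \<open>W\<close>. So the c_k converge to some
  l in \<open>F\<close>, and then x - l y is a limit of elements w_m of \<open>W\<close>.\<close>

lemma vclosed_line_extension:
  assumes F: "subfield F R" "vcomplete F"
    and W: "subgroup W (add_monoid R)" "\<And>k w. k \<in> F \<Longrightarrow> w \<in> W \<Longrightarrow> k \<otimes> w \<in> W" "vclosed W"
    and y: "y \<in> carrier R"
  shows "vclosed (line_extension F y W)"
proof (cases "y \<in> W")
  case True
  have Wc: "W \<subseteq> carrier R" using subgroup.subset[OF W(1)] by simp
  note sr = subringE[OF subfieldE(1)[OF F(1)]]
  have "line_extension F y W = W"
  proof
    show "line_extension F y W \<subseteq> W"
      using W(2)[OF _ True] add.subgroupE(4)[OF W(1)] by (auto simp: line_extension_mem_iff)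
    show "W \<subseteq> line_extension F y W"
    proof
      fix w assume "w \<in> W"
      moreover have "w = \<zero> \<otimes> y \<oplus> w" using y Wc \<open>w \<in> W\<close> by auto
      ultimately show "w \<in> line_extension F y W" using sr(2) unfolding line_extension_mem_iff by blast
    qed
  qed
  then show ?thesis using W(3) by simp
next
  case False
  note sr = subringE[OF subfieldE(1)[OF F(1)]]
  have Wc: "W \<subseteq> carrier R" using subgroup.subset[OF W(1)] by simp
  have Wd: "a \<ominus> b \<in> W" if "a \<in> W" "b \<in> W" for a b
    unfolding a_minus_def using that add.subgroupE(3,4)[OF W(1)] by auto
  have y0: "y \<noteq> \<zero>" using False add.subgroupE(2) subgroup.one_closed[OF W(1)] by auto
  obtain n :: nat where n: "\<And>w. w \<in> W \<Longrightarrow> \<not> vg (y \<ominus> w) (int n)"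
    using False W(3) y unfolding vclosed_def by blast
  show ?thesis
    unfolding vclosed_def
  proof (intro ballI impI)
    fix x assume x: "x \<in> carrier R"
      and ap: "\<forall>k::nat. \<exists>w\<in>line_extension F y W. vg (x \<ominus> w) (int k)"
    have "\<forall>k::nat. \<exists>c w. c \<in> F \<and> w \<in> W \<and> vg (x \<ominus> (c \<otimes> y \<oplus> w)) (int k)"
    proof
      fix k :: nat
      obtain u where "u \<in> line_extension F y W" "vg (x \<ominus> u) (int k)" using ap by blast
      then show "\<exists>c w. c \<in> F \<and> w \<in> W \<and> vg (x \<ominus> (c \<otimes> y \<oplus> w)) (int k)"
        by (auto simp: line_extension_mem_iff)
    qed
    then obtain c w where cw: "\<And>k::nat. c k \<in> F" "\<And>k. w k \<in> W"
        "\<And>k. vg (x \<ominus> (c k \<otimes> y \<oplus> w k)) (int k)"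
      by metis
    have cc: "c k \<in> carrier R" and wc: "w k \<in> carrier R" for k using cw(1,2)[of k] sr(1) Wc by auto
    have cauchy: "vg (c k \<ominus> c j) (int j - int n)" if jk: "j \<le> k" for j k
    proof (cases "c k = c j")
      case True
      then show ?thesis using vg_zero cc by (simp add: a_minus_def r_neg)
    next
      case False
      define d where "d = c k \<ominus> c j"
      have d: "d \<in> carrier R" "d \<noteq> \<zero>" "d \<in> F"
        using False cc cw(1) sr(5,7) by (simp_all add: d_def) (simp add: a_minus_def)
      have dinv: "inv d \<in> F" "inv d \<otimes> d = \<one>"  "d \<otimes> inv d = \<one>" "inv d \<in> carrier R"
        using subfield_m_inv[OF F(1)] d sr by auto
      \<comment> \<open>\<open>z\<close> differs from y by an element of \<open>W\<close>, so v(z) <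
        n, while d z is the difference of the two approximation errors and hence small.\<close>
      define z where "z = y \<ominus> (inv d \<otimes> (w j \<ominus> w k))"
      have z: "z \<in> carrier R" "\<not> vg z (int n)"
        using n W(2) dinv Wd cw(2) y wc by (auto simp: z_def)
      have "d \<otimes> z = d \<otimes> y \<ominus> (d \<otimes> inv d) \<otimes> (w j \<ominus> w k)"
        unfolding z_def using d(1) dinv(4) y wc[of j] wc[of k] by algebra
      also have "\<dots> = d \<otimes> y \<ominus> (w j \<ominus> w k)" using dinv(3) wc by simp
      also have "\<dots> = (x \<ominus> (c j \<otimes> y \<oplus> w j)) \<oplus> \<ominus> (x \<ominus> (c k \<otimes> y \<oplus> w k))"
        unfolding d_def using cc[of k] cc[of j] wc[of j] wc[of k] x y by algebra
      finally have dz: "d \<otimes> z = \<dots>" .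
      have "vg (x \<ominus> (c k \<otimes> y \<oplus> w k)) (int j)"
        using cw(3)[of k] jk x y cc wc by - (rule vg_mono[of _ "int k"], auto)
      then have "vg (d \<otimes> z) (int j)"
        unfolding dz using cw(3)[of j] x y cc wc by (intro vg_add vg_minus) auto
      moreover obtain t where t: "\<And>u k. u \<in> carrier R \<Longrightarrow> vg (d \<otimes> u) (k + t) \<longleftrightarrow> vg u k"
        using vg_scale[OF d(1,2)] by blast
      ultimately have "vg z (int j - t)" using t[OF z(1), of "int j - t"] by simp
      \<comment> \<open>Here t stands for v(d): v(d z) >= j forces v(z) >= j - t, which must stay
        below n. Thus t > j - n, and evaluating \<open>t\<close> at \<one> turns this into a bound
        for d itself.\<close>
      then have "int j - t < int n" using z vg_mono[OF z(1)] by (meson not_le)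
      moreover have "vg d t" using t[of \<one> 0] vg_one d by simp
      ultimately show ?thesis unfolding d_def[symmetric] using vg_mono[OF d(1)] by auto
    qed
    obtain l where l: "l \<in> F" "\<And>k. vg (l \<ominus> c k) (int k - int n)"
      using F(2) cw(1) cauchy unfolding vcomplete_def by blast
    have lc: "l \<in> carrier R" using l sr by auto
    obtain t where t: "\<And>u k. u \<in> carrier R \<Longrightarrow> vg (y \<otimes> u) (k + t) \<longleftrightarrow> vg u k"
      using vg_scale[OF y y0] by blast
    have "\<exists>u\<in>W. vg (x \<ominus> l \<otimes> y \<ominus> u) (int k)" for k :: nat
    proof
      \<comment> \<open>Two errors must reach order k: that of the m-th approximation, of order m,
        and y (l - c_m), of order m - n + t. The absolute value covers negative t.\<close>
      define m where "m = k + n + nat \<bar>t\<bar>"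
      show "w m \<in> W" by (rule cw)
      have eq: "x \<ominus> l \<otimes> y \<ominus> w m = (x \<ominus> (c m \<otimes> y \<oplus> w m)) \<oplus> \<ominus> (y \<otimes> (l \<ominus> c m))"
        using x y lc cc[of m] wc[of m] by algebra
      have "vg (x \<ominus> (c m \<otimes> y \<oplus> w m)) (int k)"
        using cw(3)[of m] x y cc wc by - (rule vg_mono[of _ "int m"], auto simp: m_def)
      moreover have "vg (y \<otimes> (l \<ominus> c m)) (int k)"
      proof (rule vg_mono)
        show "vg (y \<otimes> (l \<ominus> c m)) ((int m - int n) + t)"
          using l(2)[of m] t lc cc by simp
      qed (use y lc cc in \<open>auto simp: m_def\<close>)
      ultimately show "vg (x \<ominus> l \<otimes> y \<ominus> w m) (int k)"
        unfolding eq using x y lc cc wc by (intro vg_add vg_minus) auto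
    qed
    then have "x \<ominus> l \<otimes> y \<in> W" using W(3) x y lc unfolding vclosed_def by auto
    moreover have "x = l \<otimes> y \<oplus> (x \<ominus> l \<otimes> y)" using x y lc by algebra
    ultimately show "x \<in> line_extension F y W"
      unfolding line_extension_mem_iff using l(1) by blast
  qed
qed

lemma vclosed_Span:
  assumes F: "subfield F R" "vcomplete F" and Us: "set Us \<subseteq> carrier R"
  shows "vclosed (Span F Us)"
  using Us
proof (induction Us)
  case Nil then show ?case by (simp add: vclosed_zero)
next
  case (Cons u Us)
  have "vclosed (line_extension F u (Span F Us))"
    using Cons Span_is_add_subgroup[OF F(1)] Span_smult_closed[OF F(1)]
    by (intro vclosed_line_extension[OF F]) auto
  then show ?case by simp
qed

theorem dense_simple_extension_eq_carrier:
  assumes F: "subfield F R" "vcomplete F" and b: "b \<in> carrier R" "(algebraic over F) b"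
    and dense: "\<And>x k. x \<in> carrier R \<Longrightarrow> \<exists>w \<in> simple_extension F b. vg (x \<ominus> w) k"
  shows "simple_extension F b = carrier R"
proof
  show "simple_extension F b \<subseteq> carrier R"
    using simple_extension_in_carrier[OF subfieldE(3)[OF F(1)] b(1)] .
  have "vclosed (simple_extension F b)"
    using vclosed_Span[OF F, of "exp_base b (Polynomials.degree (Irr F b))"] Span_exp_base[OF F(1) b]
      exp_base_closed[OF b(1)] by simp
  then show "carrier R \<subseteq> simple_extension F b"
    using dense unfolding vclosed_def by blast
qed

end

section \<open>Completions\<close>

text \<open>\<open>val_mult\<close> and \<open>ge_add\<close> are all that the completion uses of
  the valuation. They are established from a uniformizer in \<open>adic_valuedI\<close>.\<close>

locale adic_valued =
  fixes K :: "complex set" and R :: "complex ring" and P :: "complex set"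
  assumes K_0: "0 \<in> K" and K_1: "1 \<in> K"
    and K_add: "x \<in> K \<Longrightarrow> y \<in> K \<Longrightarrow> x + y \<in> K"
    and K_mult: "x \<in> K \<Longrightarrow> y \<in> K \<Longrightarrow> x * y \<in> K"
    and K_uminus: "x \<in> K \<Longrightarrow> - x \<in> K"
    and K_inverse: "x \<in> K \<Longrightarrow> inverse x \<in> K"
    and val_mult: "\<lbrakk>x \<in> K; y \<in> K; x \<noteq> 0; y \<noteq> 0\<rbrakk> \<Longrightarrow>
      adic_val R P (x * y) = adic_val R P x + adic_val R P y"
    and ge_add: "\<lbrakk>x \<in> K; y \<in> K; adic_val_ge R P x k; adic_val_ge R P y k\<rbrakk> \<Longrightarrow>
      adic_val_ge R P (x + y) k"
begin

abbreviation v where "v \<equiv> adic_val R P"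
abbreviation ge where "ge \<equiv> adic_val_ge R P"
abbreviation C where "C \<equiv> cauchy_ring K R P"
abbreviation N where "N \<equiv> null_ideal K R P"
abbreviation E where "E \<equiv> completion K R P"
abbreviation cls where "cls s \<equiv> N +>\<^bsub>C\<^esub> s"

lemma K_diff: "x \<in> K \<Longrightarrow> y \<in> K \<Longrightarrow> x - y \<in> K"
  using K_add[OF _ K_uminus, of x y] by simp

lemma v_1: "v 1 = 0"
  using val_mult[of 1 1] K_1 by simp

lemma v_minus_1: "v (- 1) = 0"
  using val_mult[of "- 1" "- 1"] K_1 K_uminus[of 1] v_1 by simp

lemma v_inverse: "x \<in> K \<Longrightarrow> x \<noteq> 0 \<Longrightarrow> v (inverse x) = - v x"
  using val_mult[of x "inverse x"] K_inverse[of x] v_1 by simp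

lemma ge_0: "ge 0 k" by (simp add: adic_val_ge_def)

lemma ge_1: "ge 1 0" by (simp add: adic_val_ge_def v_1)

lemma ge_mono: "ge x k \<Longrightarrow> j \<le> k \<Longrightarrow> ge x j" by (auto simp: adic_val_ge_def)

lemma ge_uminus: assumes "x \<in> K" shows "ge (- x) k \<longleftrightarrow> ge x k"
proof (cases "x = 0")
  case False
  have "v (- 1 * x) = v x" using val_mult[of "- 1" x] assms False K_uminus[OF K_1] v_minus_1 by auto
  then show ?thesis by (simp add: adic_val_ge_def)
qed simp

lemma ge_diff: "\<lbrakk>x \<in> K; y \<in> K; ge x k; ge y k\<rbrakk> \<Longrightarrow> ge (x - y) k"
  using ge_add[OF _ K_uminus, of x y k] ge_uminus[of y k] by simp

lemma ge_diff_commute: "\<lbrakk>x \<in> K; y \<in> K\<rbrakk> \<Longrightarrow> ge (x - y) k \<longleftrightarrow> ge (y - x) k"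
  using ge_uminus[OF K_diff, of x y k] by simp

lemma ge_mult: "\<lbrakk>x \<in> K; y \<in> K; ge x j; ge y k\<rbrakk> \<Longrightarrow> ge (x * y) (j + k)"
  using val_mult[of x y] by (auto simp: adic_val_ge_def)

lemma ge_mult_iff: "\<lbrakk>x \<in> K; y \<in> K; x \<noteq> 0\<rbrakk> \<Longrightarrow> ge (x * y) (k + v x) \<longleftrightarrow> ge y k"
  using val_mult[of x y] by (auto simp: adic_val_ge_def)

lemma carrier_C: "s \<in> carrier C \<longleftrightarrow>
    (\<forall>n. s n \<in> K) \<and> (\<forall>k. \<exists>M. \<forall>m\<ge>M. \<forall>n\<ge>M. ge (s m - s n) k)"
  by (auto simp: cauchy_ring_def)

lemma C_simps [simp]:
  "s \<otimes>\<^bsub>C\<^esub> t = (\<lambda>n. s n * t n)" "\<one>\<^bsub>C\<^esub> = (\<lambda>_. 1)" "\<zero>\<^bsub>C\<^esub> = (\<lambda>_. 0)"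
  "s \<oplus>\<^bsub>C\<^esub> t = (\<lambda>n. s n + t n)"
  by (auto simp: cauchy_ring_def)

lemma mem_N: "s \<in> N \<longleftrightarrow> s \<in> carrier C \<and> (\<forall>k. \<exists>M. \<forall>n\<ge>M. ge (s n) k)"
  by (auto simp: null_ideal_def)

lemma C_K: "s \<in> carrier C \<Longrightarrow> s n \<in> K"
  by (simp add: carrier_C)

lemma C_cauchy: "s \<in> carrier C \<Longrightarrow> \<exists>M. \<forall>m\<ge>M. \<forall>n\<ge>M. ge (s m - s n) k"
  by (simp add: carrier_C)

lemma C_const: "x \<in> K \<Longrightarrow> (\<lambda>_. x) \<in> carrier C"
  by (simp add: carrier_C ge_0)

lemma C_bounded:
  assumes "s \<in> carrier C" shows "\<exists>M k. \<forall>n\<ge>M. ge (s n) k"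
proof -
  obtain M where M: "\<And>m n. m \<ge> M \<Longrightarrow> n \<ge> M \<Longrightarrow> ge (s m - s n) 0"
    using C_cauchy[OF assms] by blast
  define k where "k = min 0 (v (s M))"
  have "ge (s n) k" if "n \<ge> M" for n
  proof -
    have "ge (s M + (s n - s M)) k"
      using M[OF that order.refl] assms C_K
      by (intro ge_add K_diff) (auto intro: ge_mono simp: adic_val_ge_def k_def)
    then show ?thesis by simp
  qed
  then show ?thesis by blast
qed

lemma C_add: assumes "s \<in> carrier C" "t \<in> carrier C" shows "(\<lambda>n. s n + t n) \<in> carrier C"
  unfolding carrier_C
proof (intro conjI allI)
  show "s n + t n \<in> K" for n using assms by (simp add: C_K K_add)
  fix k
  obtain M1 M2 where "\<And>m n. m \<ge> M1 \<Longrightarrow> n \<ge> M1 \<Longrightarrow> ge (s m - s n) k"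
    "\<And>m n. m \<ge> M2 \<Longrightarrow> n \<ge> M2 \<Longrightarrow> ge (t m - t n) k"
    using C_cauchy[OF assms(1), of k] C_cauchy[OF assms(2), of k] by blast
  then have "ge ((s m - s n) + (t m - t n)) k" if "m \<ge> max M1 M2" "n \<ge> max M1 M2" for m n
    using that assms by (intro ge_add K_diff) (auto simp: C_K)
  moreover have "(s m - s n) + (t m - t n) = (s m + t m) - (s n + t n)" for m n by simp
  ultimately show "\<exists>M. \<forall>m\<ge>M. \<forall>n\<ge>M. ge ((s m + t m) - (s n + t n)) k" by metis
qed

lemma C_mult: assumes "s \<in> carrier C" "t \<in> carrier C" shows "(\<lambda>n. s n * t n) \<in> carrier C"
  unfolding carrier_C
proof (intro conjI allI)
  show "s n * t n \<in> K" for n using assms by (simp add: C_K K_mult)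
  fix k
  obtain M1 a M2 b where ab: "\<And>n. n \<ge> M1 \<Longrightarrow> ge (s n) a" "\<And>n. n \<ge> M2 \<Longrightarrow> ge (t n) b"
    using C_bounded[OF assms(1)] C_bounded[OF assms(2)] by blast
  obtain M3 M4 where M: "\<And>m n. m \<ge> M3 \<Longrightarrow> n \<ge> M3 \<Longrightarrow> ge (s m - s n) (k - b)"
    "\<And>m n. m \<ge> M4 \<Longrightarrow> n \<ge> M4 \<Longrightarrow> ge (t m - t n) (k - a)"
    using C_cauchy[OF assms(1), of "k - b"] C_cauchy[OF assms(2), of "k - a"] by blast
  define M where "M = max (max M1 M2) (max M3 M4)"
  have "ge (s m * t m - s n * t n) k" if "m \<ge> M" "n \<ge> M" for m n
  proof -
    have le: "m \<ge> M1" "m \<ge> M2" "m \<ge> M3" "m \<ge> M4" "n \<ge> M1" "n \<ge> M2" "n \<ge> M3" "n \<ge> M4"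
      using that by (auto simp: M_def)
    have "ge ((s m - s n) * t m) (k - b + b)" "ge (s n * (t m - t n)) (a + (k - a))"
      using ab M le assms C_K by (blast intro: ge_mult K_diff)+
    then have "ge ((s m - s n) * t m) k" "ge (s n * (t m - t n)) k" by simp_all
    then have "ge ((s m - s n) * t m + s n * (t m - t n)) k"
      using assms by (intro ge_add K_mult K_diff) (auto simp: C_K)
    then show ?thesis by (simp add: algebra_simps)
  qed
  then show "\<exists>M. \<forall>m\<ge>M. \<forall>n\<ge>M. ge (s m * t m - s n * t n) k" by blast
qed

lemma C_uminus: assumes "s \<in> carrier C" shows "(\<lambda>n. - s n) \<in> carrier C"
  using C_mult[OF C_const[OF K_uminus[OF K_1]] assms] by simp

lemma cring_C: "cring C"
proof (rule cringI)
  show "abelian_group C"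
    by (rule abelian_groupI)
      (auto simp: C_add C_const K_0 algebra_simps intro!: bexI[of _ "\<lambda>n. - _ n"] C_uminus)
  show "Group.comm_monoid C"
    by unfold_locales (auto simp: C_mult C_const K_1 algebra_simps)
qed (auto simp: algebra_simps)

sublocale C: cring C by (rule cring_C)

lemma C_a_inv: assumes "s \<in> carrier C" shows "\<ominus>\<^bsub>C\<^esub> s = (\<lambda>n. - s n)"
  using assms by (intro C.minus_equality) (auto simp: C_uminus)

lemma N_C: "s \<in> N \<Longrightarrow> s \<in> carrier C" by (simp add: mem_N)

lemma N_0: "(\<lambda>_. 0) \<in> N" using C_const[OF K_0] by (auto simp: mem_N ge_0)

lemma N_add: assumes "s \<in> N" "t \<in> N" shows "(\<lambda>n. s n + t n) \<in> N"
  unfolding mem_N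
proof (intro conjI allI)
  show "(\<lambda>n. s n + t n) \<in> carrier C" using assms by (auto intro: C_add N_C)
  fix k
  obtain M1 M2 where "\<And>n. n \<ge> M1 \<Longrightarrow> ge (s n) k" "\<And>n. n \<ge> M2 \<Longrightarrow> ge (t n) k"
    using assms unfolding mem_N by blast
  then have "\<forall>n\<ge>max M1 M2. ge (s n + t n) k"
    using assms by (auto intro!: ge_add C_K N_C)
  then show "\<exists>M. \<forall>n\<ge>M. ge (s n + t n) k" by blast
qed

lemma N_mult: assumes "s \<in> carrier C" "t \<in> N" shows "(\<lambda>n. s n * t n) \<in> N"
  unfolding mem_N
proof (intro conjI allI)
  show "(\<lambda>n. s n * t n) \<in> carrier C" using assms by (auto intro: C_mult N_C)
  fix k
  obtain M1 a where a: "\<And>n. n \<ge> M1 \<Longrightarrow> ge (s n) a" using C_bounded[OF assms(1)] by blast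
  obtain M2 where "\<And>n. n \<ge> M2 \<Longrightarrow> ge (t n) (k - a)" using assms(2) unfolding mem_N by blast
  then have "\<forall>n\<ge>max M1 M2. ge (s n * t n) (a + (k - a))"
    using assms a by (intro allI impI ge_mult) (auto intro!: C_K N_C)
  then have "\<forall>n\<ge>max M1 M2. ge (s n * t n) k" by simp
  then show "\<exists>M. \<forall>n\<ge>M. ge (s n * t n) k" by blast
qed

lemma N_uminus: assumes "s \<in> N" shows "(\<lambda>n. - s n) \<in> N"
  using N_mult[OF C_const[OF K_uminus[OF K_1]] assms] by simp

lemma ideal_N: "ideal N C"
proof (rule idealI)
  show "ring C" by (rule C.ring_axioms)
  show "subgroup N (add_monoid C)"
    by (rule C.add.subgroupI)
      (use N_0 in \<open>auto simp: N_C N_add N_uminus C_a_inv simp flip: a_inv_def\<close>)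
  show "\<And>s t. s \<in> N \<Longrightarrow> t \<in> carrier C \<Longrightarrow> t \<otimes>\<^bsub>C\<^esub> s \<in> N" by (simp add: N_mult)
  show "s \<otimes>\<^bsub>C\<^esub> t \<in> N" if "s \<in> N" "t \<in> carrier C" for s t
    using N_mult[OF that(2,1)] by (simp add: mult.commute)
qed

sublocale N: ideal N C by (rule ideal_N)

lemma cls_hom: "(\<lambda>s. N +>\<^bsub>C\<^esub> s) \<in> ring_hom C E"
  unfolding completion_def by (rule N.rcos_ring_hom)

lemma carrier_E: "carrier E = (\<lambda>s. cls s) ` carrier C"
  unfolding completion_def FactRing_def A_RCOSETS_def' by auto

lemma cls_closed: "s \<in> carrier C \<Longrightarrow> cls s \<in> carrier E"
  by (auto simp: carrier_E)

lemma E_cases: assumes "A \<in> carrier E" obtains s where "s \<in> carrier C" "A = cls s"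
  using assms by (auto simp: carrier_E)

lemma cring_E: "cring E"
  unfolding completion_def by (rule N.quotient_is_cring[OF cring_C])

sublocale E: cring E by (rule cring_E)

lemma cls_add: "s \<in> carrier C \<Longrightarrow> t \<in> carrier C \<Longrightarrow> cls s \<oplus>\<^bsub>E\<^esub> cls t = cls (\<lambda>n. s n + t n)"
  using ring_hom_add[OF cls_hom, of s t] by simp

lemma cls_mult: "s \<in> carrier C \<Longrightarrow> t \<in> carrier C \<Longrightarrow> cls s \<otimes>\<^bsub>E\<^esub> cls t = cls (\<lambda>n. s n * t n)"
  using ring_hom_mult[OF cls_hom, of s t] by simp

lemma cls_one: "cls (\<lambda>_. 1) = \<one>\<^bsub>E\<^esub>"
  using ring_hom_one[OF cls_hom] by simp

lemma cls_zero: "cls (\<lambda>_. 0) = \<zero>\<^bsub>E\<^esub>"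
  using ring_hom_zero[OF cls_hom C.ring_axioms E.ring_axioms] by simp

lemma cls_uminus: assumes "s \<in> carrier C" shows "\<ominus>\<^bsub>E\<^esub> cls s = cls (\<lambda>n. - s n)"
  using assms by (intro E.minus_equality) (auto simp: cls_add cls_zero C_uminus cls_closed)

lemma cls_diff: "s \<in> carrier C \<Longrightarrow> t \<in> carrier C \<Longrightarrow> cls s \<ominus>\<^bsub>E\<^esub> cls t = cls (\<lambda>n. s n - t n)"
  by (simp add: a_minus_def cls_uminus cls_add C_uminus)

lemma cls_eq_zero_iff: assumes "s \<in> carrier C" shows "cls s = \<zero>\<^bsub>E\<^esub> \<longleftrightarrow> s \<in> N"
proof -
  have "\<zero>\<^bsub>E\<^esub> = N" by (simp add: completion_def FactRing_def)
  then show ?thesis using N.a_rcos_self[OF assms] N.a_rcos_const[of s] assms by auto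
qed

lemma cls_eq_iff: assumes "s \<in> carrier C" "t \<in> carrier C"
  shows "cls s = cls t \<longleftrightarrow> (\<lambda>n. s n - t n) \<in> N"
  using assms cls_diff[OF assms] cls_eq_zero_iff[of "\<lambda>n. s n - t n"]
    C_add[OF assms(1) C_uminus[OF assms(2)]] E.r_right_minus_eq[OF cls_closed cls_closed]
  by auto

text \<open>A non-null sequence has a late term of valuation w < k, where all later differences have
  valuation at least k. The ultrametric inequality then gives every later term exactly the valuation
  w.\<close>

lemma not_null_eventually_const_val:
  assumes s: "s \<in> carrier C" "s \<notin> N"
  shows "\<exists>M w. \<forall>n\<ge>M. s n \<noteq> 0 \<and> v (s n) = w"
proof -
  obtain k where k: "\<And>M. \<exists>n\<ge>M. \<not> ge (s n) k" using s unfolding mem_N by blast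
  obtain M where M: "\<And>m n. m \<ge> M \<Longrightarrow> n \<ge> M \<Longrightarrow> ge (s m - s n) k"
    using C_cauchy[OF s(1)] by blast
  obtain n0 where n0: "n0 \<ge> M" "\<not> ge (s n0) k" using k by blast
  define w where "w = v (s n0)"
  have w: "s n0 \<noteq> 0" "w < k" "ge (s n0) w" "\<not> ge (s n0) (w + 1)"
    using n0(2) by (auto simp: adic_val_ge_def w_def)
  have "s m \<noteq> 0 \<and> v (s m) = w" if "m \<ge> M" for m
  proof -
    have d: "ge (s m - s n0) (w + 1)" using M[OF that n0(1)] w(2) ge_mono by auto
    have "ge (s n0 + (s m - s n0)) w"
      using w d s(1) by (intro ge_add K_diff) (auto simp: C_K intro: ge_mono)
    then have 1: "ge (s m) w" by simp
    have 2: "\<not> ge (s m) (w + 1)"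
    proof
      assume "ge (s m) (w + 1)"
      then have "ge (s m - (s m - s n0)) (w + 1)"
        using ge_diff[OF _ K_diff _ d] C_K[OF s(1)] by blast
      then show False using w(4) by simp
    qed
    from 1 2 show ?thesis by (auto simp: adic_val_ge_def)
  qed
  then show ?thesis by blast
qed

text \<open>Inversion is termwise. Since 1/s_m - 1/s_n = (s_n - s_m) / (s_m s_n), it costs 2 w in
  valuation, whence the bound k + 2 w. Early terms may vanish; as inverse 0 = 0, the sequence stays
  in \<open>K\<close>, and s t - 1 is eventually 0.\<close>

lemma inverse_exists:
  assumes s: "s \<in> carrier C" "s \<notin> N"
  shows "\<exists>t \<in> carrier C. cls s \<otimes>\<^bsub>E\<^esub> cls t = \<one>\<^bsub>E\<^esub>"
proof -
  obtain M w where w: "\<And>n. n \<ge> M \<Longrightarrow> s n \<noteq> 0 \<and> v (s n) = w"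
    using not_null_eventually_const_val[OF s] by blast
  define t where "t = (\<lambda>n. inverse (s n))"
  have tK: "t n \<in> K" for n using C_K[OF s(1)] K_inverse by (simp add: t_def)
  have t: "t \<in> carrier C" unfolding carrier_C
  proof (intro conjI allI tK)
    fix k
    obtain M' where M': "\<And>m n. m \<ge> M' \<Longrightarrow> n \<ge> M' \<Longrightarrow> ge (s m - s n) (k + 2 * w)"
      using C_cauchy[OF s(1)] by blast
    have "ge (t m - t n) k" if "m \<ge> max M M'" "n \<ge> max M M'" for m n
    proof -
      have nz: "s m \<noteq> 0" "s n \<noteq> 0" "v (s m) = w" "v (s n) = w" using w that by auto
      have "ge (t m) (- w)" "ge (t n) (- w)"
        using nz C_K[OF s(1)] by (auto simp: adic_val_ge_def t_def v_inverse)
      then have "ge ((s n - s m) * (t m * t n)) ((k + 2 * w) + (- w + - w))"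
        using M' that tK C_K[OF s(1)] by (intro ge_mult K_mult K_diff) auto
      moreover have "(s n - s m) * (t m * t n) = t m - t n"
        using nz by (simp add: t_def field_simps)
      ultimately show ?thesis by simp
    qed
    then show "\<exists>M. \<forall>m\<ge>M. \<forall>n\<ge>M. ge (t m - t n) k" by blast
  qed
  have st: "(\<lambda>n. s n * t n) \<in> carrier C" by (rule C_mult[OF s(1) t])
  have one: "(\<lambda>n. 1) \<in> carrier C" by (rule C_const[OF K_1])
  have "(\<lambda>n. s n * t n - 1) \<in> N"
    unfolding mem_N
  proof (intro conjI allI)
    show "(\<lambda>n. s n * t n - 1) \<in> carrier C" using C_add[OF st C_uminus[OF one]] by simp
    show "\<exists>M. \<forall>n\<ge>M. ge (s n * t n - 1) k" for k
      using w by (intro exI[of _ M]) (auto simp: t_def ge_0)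
  qed
  then have "cls s \<otimes>\<^bsub>E\<^esub> cls t = \<one>\<^bsub>E\<^esub>"
    using cls_mult[OF s(1) t] cls_eq_iff[OF st one] by (simp add: cls_one)
  then show ?thesis using t by blast
qed

lemma field_E: "field E"
proof (rule E.cring_fieldI2)
  show "\<zero>\<^bsub>E\<^esub> \<noteq> \<one>\<^bsub>E\<^esub>"
  proof
    assume "\<zero>\<^bsub>E\<^esub> = \<one>\<^bsub>E\<^esub>"
    then have "(\<lambda>_. 1) \<in> N" using cls_eq_zero_iff[OF C_const[OF K_1]] by (simp add: cls_one)
    then obtain M :: nat where "\<And>n. n \<ge> M \<Longrightarrow> ge 1 1" unfolding mem_N by blast
    from this[of M] have "ge 1 1" by simp
    then show False using v_1 by (simp add: adic_val_ge_def)
  qed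
  fix A assume A: "A \<in> carrier E" "A \<noteq> \<zero>\<^bsub>E\<^esub>"
  then obtain s where "s \<in> carrier C" "A = cls s" by (auto elim: E_cases)
  then show "\<exists>Y\<in>carrier E. A \<otimes>\<^bsub>E\<^esub> Y = \<one>\<^bsub>E\<^esub>"
    using A inverse_exists[of s] cls_eq_zero_iff[of s] cls_closed by blast
qed

text \<open>One representative suffices here; by \<open>vg_cls\<close> the choice is
  immaterial.\<close>

definition vg :: "(nat \<Rightarrow> complex) set \<Rightarrow> int \<Rightarrow> bool" where
  "vg A k \<longleftrightarrow> (\<exists>s \<in> carrier C. A = cls s \<and> (\<exists>M. \<forall>n\<ge>M. ge (s n) k))"

lemma vg_cls: assumes s: "s \<in> carrier C" shows "vg (cls s) k \<longleftrightarrow> (\<exists>M. \<forall>n\<ge>M. ge (s n) k)"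
proof
  assume "vg (cls s) k"
  then obtain t M where t: "t \<in> carrier C" "cls s = cls t" "\<And>n. n \<ge> M \<Longrightarrow> ge (t n) k"
    unfolding vg_def by blast
  then have "(\<lambda>n. s n - t n) \<in> N" using cls_eq_iff[OF s t(1)] by simp
  then obtain M' where M': "\<And>n. n \<ge> M' \<Longrightarrow> ge (s n - t n) k" unfolding mem_N by blast
  have "ge ((s n - t n) + t n) k" if "n \<ge> max M M'" for n
    using that M' t s by (intro ge_add K_diff) (auto simp: C_K)
  then have "\<forall>n\<ge>max M M'. ge (s n) k" by simp
  then show "\<exists>M. \<forall>n\<ge>M. ge (s n) k" by blast
qed (use s in \<open>auto simp: vg_def\<close>)

lemma vg_const: "x \<in> K \<Longrightarrow> vg (cls (\<lambda>_. x)) k \<longleftrightarrow> ge x k"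
  by (auto simp: vg_cls C_const)

lemma nonarch_field_E: "nonarch_field E vg"
proof -
  interpret E: field E by (rule field_E)
  show ?thesis
  proof unfold_locales
    show "vg \<one>\<^bsub>E\<^esub> 0" using vg_const[OF K_1, of 0] ge_1 by (simp add: cls_one)
    show "vg \<zero>\<^bsub>E\<^esub> k" for k using vg_const[OF K_0, of k] ge_0 by (simp add: cls_zero)
  next
    fix A Y k assume *: "A \<in> carrier E" "Y \<in> carrier E" "vg A k" "vg Y k"
    obtain s t where st: "s \<in> carrier C" "A = cls s" "t \<in> carrier C" "Y = cls t"
      using * by (auto elim!: E_cases)
    obtain M1 M2 where "\<And>n. n \<ge> M1 \<Longrightarrow> ge (s n) k" "\<And>n. n \<ge> M2 \<Longrightarrow> ge (t n) k"
      using * st by (auto simp: vg_cls)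
    then have "\<forall>n\<ge>max M1 M2. ge (s n + t n) k" using st by (auto intro!: ge_add C_K)
    then have "\<exists>M. \<forall>n\<ge>M. ge (s n + t n) k" by blast
    then show "vg (A \<oplus>\<^bsub>E\<^esub> Y) k"
      using st by (simp add: cls_add vg_cls C_add)
  next
    fix A k assume *: "A \<in> carrier E" "vg A k"
    obtain s where "s \<in> carrier C" "A = cls s" using * by (auto elim!: E_cases)
    then show "vg (\<ominus>\<^bsub>E\<^esub> A) k"
      using * by (auto simp: cls_uminus vg_cls C_uminus ge_uminus C_K)
  next
    fix A k j assume *: "A \<in> carrier E" "vg A k" "(j::int) \<le> k"
    then show "vg A j" unfolding vg_def using ge_mono by blast
  next
    fix A assume *: "A \<in> carrier E" "\<And>k. vg A k"
    obtain s where "s \<in> carrier C" "A = cls s" using * by (auto elim!: E_cases)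
    then show "A = \<zero>\<^bsub>E\<^esub>" using * cls_eq_zero_iff[of s] by (simp add: vg_cls mem_N)
  next
    fix A assume A: "A \<in> carrier E" "A \<noteq> \<zero>\<^bsub>E\<^esub>"
    then obtain s where s: "s \<in> carrier C" "A = cls s" by (auto elim!: E_cases)
    then have "s \<notin> N" using A cls_eq_zero_iff[of s] by auto
    then obtain M w where w: "\<And>n. n \<ge> M \<Longrightarrow> s n \<noteq> 0 \<and> v (s n) = w"
      using not_null_eventually_const_val[OF s(1)] by blast
    have "vg (A \<otimes>\<^bsub>E\<^esub> Y) (k + w) \<longleftrightarrow> vg Y k" if Y: "Y \<in> carrier E" for Y k
    proof -
      obtain t where t: "t \<in> carrier C" "Y = cls t" using E_cases[OF Y] by blast
      have iff: "ge (s n * t n) (k + w) \<longleftrightarrow> ge (t n) k" if "n \<ge> M" for n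
        using ge_mult_iff[of "s n" "t n" k] w[OF that] s t by (auto simp: C_K)
      have "(\<exists>M. \<forall>n\<ge>M. ge (s n * t n) (k + w)) \<longleftrightarrow> (\<exists>M. \<forall>n\<ge>M. ge (t n) k)"
        using iff by (metis max.bounded_iff max.cobounded1 max.cobounded2)
      then show ?thesis using s t by (simp add: cls_mult vg_cls C_mult)
    qed
    then show "\<exists>w. \<forall>Y\<in>carrier E. \<forall>k. vg (A \<otimes>\<^bsub>E\<^esub> Y) (k + w) = vg Y k" by blast
  qed
qed

text \<open>Density of \<open>K\<close> in its completion: a Cauchy sequence is close to the
  constant sequence at any late term.\<close>

lemma const_dense:
  assumes s: "s \<in> carrier C"
  shows "\<exists>M. \<forall>n\<ge>M. vg (cls s \<ominus>\<^bsub>E\<^esub> cls (\<lambda>_. s n)) k"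
proof -
  obtain M where M: "\<And>m n. m \<ge> M \<Longrightarrow> n \<ge> M \<Longrightarrow> ge (s m - s n) k"
    using C_cauchy[OF s] by blast
  have "vg (cls (\<lambda>m. s m - s n)) k" if "n \<ge> M" for n
    using that M C_add[OF s C_uminus[OF C_const[OF C_K[OF s, of n]]]] by (auto simp: vg_cls)
  then show ?thesis using s by (auto simp: cls_diff C_const C_K)
qed

end

section \<open>Completions of an extension of valued fields\<close>

lemma (in cring) diff_telescope2:
  "\<lbrakk>a \<in> carrier R; b \<in> carrier R; c \<in> carrier R\<rbrakk> \<Longrightarrow>
    a \<ominus> b = (a \<ominus> c) \<oplus> \<ominus> (b \<ominus> c)"
  by algebra

lemma (in cring) diff_telescope3:
  "\<lbrakk>a \<in> carrier R; b \<in> carrier R; c \<in> carrier R; d \<in> carrier R\<rbrakk> \<Longrightarrow>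
    a \<ominus> b = (c \<ominus> d) \<oplus> ((d \<ominus> b) \<oplus> \<ominus> (c \<ominus> a))"
  by algebra

text \<open>\<open>e\<close> is the ramification index. As it is positive, the topology of
  \<open>L\<close> at \<open>Q\<close> induces that of \<open>K\<close> at \<open>P\<close>.\<close>

locale adic_extension = k: adic_valued K R P + l: adic_valued L S Q
  for K R P L S Q +
  fixes e :: int
  assumes K_L: "K \<subseteq> L" and e: "e > 0"
    and val_ext: "\<lbrakk>x \<in> K; x \<noteq> 0\<rbrakk> \<Longrightarrow> adic_val S Q x = e * adic_val R P x"
begin

lemma ge_ext: assumes "x \<in> K" shows "l.ge x (e * m) \<longleftrightarrow> k.ge x m"
  using e val_ext[OF assms] by (auto simp: adic_val_ge_def)

text \<open>Absolute values make one bound serve both signs of m: m <= |m| here, and m <= e |m| in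
  the converse direction.\<close>

lemma ge_l_imp_k: assumes "x \<in> K" "l.ge x (e * \<bar>m\<bar>)" shows "k.ge x m"
  using ge_ext[OF assms(1)] assms(2) k.ge_mono by (metis abs_ge_self)

lemma ge_k_imp_l: assumes "x \<in> K" "k.ge x \<bar>m\<bar>" shows "l.ge x m"
proof -
  have "l.ge x (e * \<bar>m\<bar>)" using ge_ext[OF assms(1)] assms(2) by simp
  moreover have "m \<le> e * \<bar>m\<bar>" using e mult_right_mono[of 1 e "\<bar>m\<bar>"] by auto
  ultimately show ?thesis using l.ge_mono by blast
qed

lemma C_iff: assumes "\<And>n. s n \<in> K" shows "s \<in> carrier k.C \<longleftrightarrow> s \<in> carrier l.C"
  unfolding k.carrier_C l.carrier_C
  using assms K_L ge_l_imp_k[OF k.K_diff[OF assms assms]] ge_k_imp_l[OF k.K_diff[OF assms assms]]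
  by (meson subset_iff)

lemma C_subset: "carrier k.C \<subseteq> carrier l.C"
  using C_iff k.C_K by blast

lemma N_subset: "k.N \<subseteq> l.N"
proof
  fix s assume s: "s \<in> k.N"
  then have "s n \<in> K" for n by (auto simp: k.N_C k.C_K)
  then show "s \<in> l.N"
    using s C_subset unfolding k.mem_N l.mem_N by (meson ge_k_imp_l subset_iff)
qed

text \<open>The null ideal of \<open>L\<close> absorbs that of \<open>K\<close>, so the embedding
  merely keeps the representing sequence.\<close>

lemma completion_embed_cls:
  assumes "s \<in> carrier k.C" shows "completion_embed L S Q (k.cls s) = l.cls s"
proof -
  have "completion_embed L S Q (k.cls s) = {\<lambda>n. a n + (b n + s n) | a b. a \<in> l.N \<and> b \<in> k.N}"
    unfolding completion_embed_def set_add_def' a_r_coset_def' by auto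
  also have "\<dots> = {\<lambda>n. a n + s n | a. a \<in> l.N}"
  proof (intro equalityI subsetI; clarify)
    fix a b assume "a \<in> l.N" "b \<in> k.N"
    then have "(\<lambda>n. a n + b n) \<in> l.N" using N_subset by (auto intro: l.N_add)
    then show "\<exists>a'. (\<lambda>n. a n + (b n + s n)) = (\<lambda>n. a' n + s n) \<and> a' \<in> l.N"
      by (intro exI[of _ "\<lambda>n. a n + b n"]) (auto simp: add.assoc)
  next
    fix a assume "a \<in> l.N"
    then show "\<exists>a' b. (\<lambda>n. a n + s n) = (\<lambda>n. a' n + (b n + s n)) \<and> a' \<in> l.N \<and> b \<in> k.N"
      using k.N_0 by (intro exI[of _ a] exI[of _ "\<lambda>_. 0"]) auto
  qed
  also have "\<dots> = l.cls s" unfolding a_r_coset_def' by auto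
  finally show ?thesis .
qed

lemma completion_embed_hom: "completion_embed L S Q \<in> ring_hom k.E l.E"
proof (rule ring_hom_memI)
  fix A assume "A \<in> carrier k.E"
  then obtain s where s: "s \<in> carrier k.C" "A = k.cls s" by (auto elim: k.E_cases)
  then show "completion_embed L S Q A \<in> carrier l.E"
    using C_subset by (auto simp: completion_embed_cls l.cls_closed)
  fix Y assume "Y \<in> carrier k.E"
  then obtain t where t: "t \<in> carrier k.C" "Y = k.cls t" by (auto elim: k.E_cases)
  show "completion_embed L S Q (A \<otimes>\<^bsub>k.E\<^esub> Y) = completion_embed L S Q A \<otimes>\<^bsub>l.E\<^esub> completion_embed L S Q Y"
    using s t C_subset
    by (simp add: k.cls_mult completion_embed_cls k.C_mult l.cls_mult subset_iff)
  show "completion_embed L S Q (A \<oplus>\<^bsub>k.E\<^esub> Y) = completion_embed L S Q A \<oplus>\<^bsub>l.E\<^esub> completion_embed L S Q Y"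
    using s t C_subset
    by (simp add: k.cls_add completion_embed_cls k.C_add l.cls_add subset_iff)
next
  show "completion_embed L S Q \<one>\<^bsub>k.E\<^esub> = \<one>\<^bsub>l.E\<^esub>"
    using completion_embed_cls[OF k.C_const[OF k.K_1]] by (simp add: k.cls_one l.cls_one)
qed

definition F where "F = completion_embed L S Q ` carrier k.E"

lemma F_eq: "F = (\<lambda>s. l.cls s) ` carrier k.C"
  unfolding F_def k.carrier_E image_image by (intro image_cong refl completion_embed_cls)

lemma subfield_F: "subfield F l.E"
proof -
  interpret lE: field l.E by (rule l.field_E)
  interpret kE: field k.E by (rule k.field_E)
  interpret h: ring_hom_ring k.E l.E "completion_embed L S Q"
    by (rule ring_hom_ringI2[OF k.E.ring_axioms l.E.ring_axioms completion_embed_hom])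
  show ?thesis unfolding F_def
    by (rule h.img_is_subfield(2)[OF kE.carrier_is_subfield lE.one_not_zero])
qed

sublocale lE: nonarch_field l.E l.vg by (rule l.nonarch_field_E)

text \<open>A diagonal argument: approximate the k-th term of the sequence to order k by some y_k in
  \<open>K\<close>. The sequence y inherits the rate of convergence, so it is Cauchy in
  \<open>L\<close>; its terms lie in \<open>K\<close>, so it is Cauchy in \<open>K\<close> as well,
  and its class is the limit in \<open>F\<close>.\<close>

lemma vcomplete_F: "lE.vcomplete F"
  unfolding lE.vcomplete_def
proof (intro allI impI)
  fix c :: "nat \<Rightarrow> _" and n :: nat
  assume "(\<forall>k. c k \<in> F) \<and> (\<forall>j k. j \<le> k \<longrightarrow> l.vg (c k \<ominus>\<^bsub>l.E\<^esub> c j) (int j - int n))"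
  then have c: "\<And>k. c k \<in> F" "\<And>j k. j \<le> k \<Longrightarrow> l.vg (c k \<ominus>\<^bsub>l.E\<^esub> c j) (int j - int n)" by auto
  have cE: "c k \<in> carrier l.E" for k
    using c(1)[of k] C_subset l.cls_closed by (auto simp: F_eq)
  have "\<forall>k. \<exists>y. y \<in> K \<and> l.vg (c k \<ominus>\<^bsub>l.E\<^esub> l.cls (\<lambda>_. y)) (int k)"
  proof
    fix k
    obtain s where s: "s \<in> carrier k.C" "c k = l.cls s" using c(1)[of k] by (auto simp: F_eq)
    then obtain M where "l.vg (c k \<ominus>\<^bsub>l.E\<^esub> l.cls (\<lambda>_. s M)) (int k)"
      using l.const_dense[of s "int k"] C_subset by auto
    then show "\<exists>y. y \<in> K \<and> l.vg (c k \<ominus>\<^bsub>l.E\<^esub> l.cls (\<lambda>_. y)) (int k)"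
      using k.C_K[OF s(1)] by blast
  qed
  then obtain y where y: "\<And>k. y k \<in> K" "\<And>k. l.vg (c k \<ominus>\<^bsub>l.E\<^esub> l.cls (\<lambda>_. y k)) (int k)"
    by metis
  have yL: "y k \<in> L" for k using y(1) K_L by auto
  have yE: "l.cls (\<lambda>_. y k) \<in> carrier l.E" for k by (intro l.cls_closed l.C_const yL)
  have ycauchy: "l.ge (y k - y j) (int j - int n)" if "j \<le> k" for j k
  proof -
    have "l.cls (\<lambda>_. y k) \<ominus>\<^bsub>l.E\<^esub> l.cls (\<lambda>_. y j) =
        (c k \<ominus>\<^bsub>l.E\<^esub> c j) \<oplus>\<^bsub>l.E\<^esub> ((c j \<ominus>\<^bsub>l.E\<^esub> l.cls (\<lambda>_. y j)) \<oplus>\<^bsub>l.E\<^esub> \<ominus>\<^bsub>l.E\<^esub> (c k \<ominus>\<^bsub>l.E\<^esub> l.cls (\<lambda>_. y k)))"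
      by (intro l.E.diff_telescope3 yE cE)
    moreover have "l.vg \<dots> (int j - int n)"
    proof (intro lE.vg_add lE.vg_minus)
      show "l.vg (c j \<ominus>\<^bsub>l.E\<^esub> l.cls (\<lambda>_. y j)) (int j - int n)"
        using cE yE by - (rule lE.vg_mono[OF _ y(2)], auto)
      show "l.vg (c k \<ominus>\<^bsub>l.E\<^esub> l.cls (\<lambda>_. y k)) (int j - int n)"
        using cE yE that by - (rule lE.vg_mono[OF _ y(2)], auto)
    qed (use cE yE c(2)[OF that] in auto)
    ultimately have "l.vg (l.cls (\<lambda>_. y k - y j)) (int j - int n)"
      using yL by (simp add: l.cls_diff l.C_const)
    then show ?thesis using yL by (simp add: l.vg_const l.K_diff)
  qed
  have yC: "y \<in> carrier l.C"
    unfolding l.carrier_C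
  proof (intro conjI allI yL)
    fix k :: int
    define M where "M = nat (k + int n)"
    have "l.ge (y i - y j) k" if "i \<ge> M" "j \<ge> M" for i j
    proof (cases "j \<le> i")
      case True
      have "k \<le> int j - int n" using that by (simp add: M_def)
      then show ?thesis using ycauchy[OF True] l.ge_mono by blast
    next
      case False
      then have "l.ge (y j - y i) (int i - int n)" by (intro ycauchy) auto
      moreover have "k \<le> int i - int n" using that by (simp add: M_def)
      ultimately show ?thesis using l.ge_mono l.ge_diff_commute[OF yL yL] by blast
    qed
    then show "\<exists>M. \<forall>i\<ge>M. \<forall>j\<ge>M. l.ge (y i - y j) k" by blast
  qed
  then have yk: "y \<in> carrier k.C" using C_iff y(1) by blast
  show "\<exists>l\<in>F. \<forall>k. l.vg (l \<ominus>\<^bsub>l.E\<^esub> c k) (int k - int n)"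
  proof (intro bexI allI)
    show "l.cls y \<in> F" using yk by (auto simp: F_eq)
    fix k
    have yyE: "l.cls y \<in> carrier l.E" by (rule l.cls_closed[OF yC])
    have "l.cls y \<ominus>\<^bsub>l.E\<^esub> c k = (l.cls y \<ominus>\<^bsub>l.E\<^esub> l.cls (\<lambda>_. y k)) \<oplus>\<^bsub>l.E\<^esub> \<ominus>\<^bsub>l.E\<^esub> (c k \<ominus>\<^bsub>l.E\<^esub> l.cls (\<lambda>_. y k))"
      by (intro l.E.diff_telescope2 yE cE yyE)
    moreover have "l.vg \<dots> (int k - int n)"
    proof (intro lE.vg_add lE.vg_minus)
      show "l.vg (c k \<ominus>\<^bsub>l.E\<^esub> l.cls (\<lambda>_. y k)) (int k - int n)"
        using cE yE by - (rule lE.vg_mono[OF _ y(2)], auto)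
      have "(\<lambda>m. y m - y k) \<in> carrier l.C"
        using l.C_add[OF yC l.C_uminus[OF l.C_const[OF yL]]] by simp
      then show "l.vg (l.cls y \<ominus>\<^bsub>l.E\<^esub> l.cls (\<lambda>_. y k)) (int k - int n)"
        using yC yL ycauchy[of k] by (auto simp: l.cls_diff l.C_const l.vg_cls)
    qed (use cE yE yyE in auto)
    ultimately show "l.vg (l.cls y \<ominus>\<^bsub>l.E\<^esub> c k) (int k - int n)" by simp
  qed
qed

end

section \<open>Prime ideals of orders\<close>

interpretation QV: vector_space "\<lambda>(r::rat) (x::complex). of_rat r * x"
  by unfold_locales (simp_all add: algebra_simps of_rat_add of_rat_mult)

text \<open>Made to fit both Z[\<xi>] and the ring of integers of \<open>L\<close>. Instead of
  finite generation as a group, \<open>S_rank\<close> asks only that S lie in a finite dimensional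
  rational space.\<close>

locale prime_of_order =
  fixes S P :: "complex set" and p :: nat
  assumes S_1: "1 \<in> S"
    and S_add: "x \<in> S \<Longrightarrow> y \<in> S \<Longrightarrow> x + y \<in> S"
    and S_uminus: "x \<in> S \<Longrightarrow> - x \<in> S"
    and S_mult: "x \<in> S \<Longrightarrow> y \<in> S \<Longrightarrow> x * y \<in> S"
    and S_integral: "x \<in> S \<Longrightarrow> algebraic_int x"
    and S_rank: "\<exists>B. finite B \<and> S \<subseteq> QV.span B"
    and p: "Factorial_Ring.prime p"
    and P_S: "P \<subseteq> S"
    and P_0: "0 \<in> P"
    and P_add: "x \<in> P \<Longrightarrow> y \<in> P \<Longrightarrow> x + y \<in> P"
    and P_mult: "x \<in> S \<Longrightarrow> y \<in> P \<Longrightarrow> x * y \<in> P"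
    and P_1: "1 \<notin> P"
    and P_prime: "\<lbrakk>x \<in> S; y \<in> S; x * y \<in> P\<rbrakk> \<Longrightarrow> x \<in> P \<or> y \<in> P"
    and p_P: "of_nat p \<in> P"
begin

lemma S_0: "0 \<in> S" using P_0 P_S by auto

lemma S_diff: "x \<in> S \<Longrightarrow> y \<in> S \<Longrightarrow> x - y \<in> S"
  using S_add[OF _ S_uminus, of x y] by simp

lemma P_uminus: "x \<in> P \<Longrightarrow> - x \<in> P"
  using P_mult[OF S_uminus[OF S_1], of x] by simp

lemma P_mult2: "x \<in> P \<Longrightarrow> y \<in> S \<Longrightarrow> x * y \<in> P"
  using P_mult[of y x] by (simp add: mult.commute)

lemma S_power: "x \<in> S \<Longrightarrow> x ^ n \<in> S"
  by (induction n) (auto simp: S_1 S_mult)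

lemma P_power: "x \<in> P \<Longrightarrow> n > 0 \<Longrightarrow> x ^ n \<in> P"
  using P_S S_power by (cases n) (auto intro: P_mult2)

lemma S_of_nat: "of_nat n \<in> S"
  by (induction n) (auto simp: S_0 S_1 S_add)

lemma S_of_int: "of_int n \<in> S"
  using S_of_nat S_uminus by (cases n rule: int_cases2) auto

lemma S_sum: "(\<And>i. i \<in> I \<Longrightarrow> f i \<in> S) \<Longrightarrow> sum f I \<in> S"
  by (induction I rule: infinite_finite_induct) (auto simp: S_0 S_add)

lemma notP_mult: "\<lbrakk>x \<in> S - P; y \<in> S - P\<rbrakk> \<Longrightarrow> x * y \<in> S - P"
  using P_prime S_mult by auto

lemma notP_power: "x \<in> S - P \<Longrightarrow> x ^ n \<in> S - P"
  by (induction n) (auto simp: P_1 S_1 intro: S_mult dest: P_prime)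

section \<open>The residue ring S / p S and its finiteness\<close>

definition pS :: "complex set" where "pS = (*) (of_nat p) ` S"

lemma pS_I: "x \<in> S \<Longrightarrow> of_nat p * x \<in> pS" by (auto simp: pS_def)

lemma pS_E: "x \<in> pS \<Longrightarrow> (\<And>y. x = of_nat p * y \<Longrightarrow> y \<in> S \<Longrightarrow> thesis) \<Longrightarrow> thesis"
  by (auto simp: pS_def)

lemma pS_P: "pS \<subseteq> P" using p_P P_mult2 by (auto simp: pS_def)

lemma pS_0: "0 \<in> pS" using pS_I[OF S_0] by simp

lemma pS_add: "x \<in> pS \<Longrightarrow> y \<in> pS \<Longrightarrow> x + y \<in> pS"
  using S_add by (auto simp: pS_def simp flip: distrib_left)

lemma pS_mult: "x \<in> S \<Longrightarrow> y \<in> pS \<Longrightarrow> x * y \<in> pS"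
  using S_mult by (auto simp: pS_def mult.left_commute)

lemma pS_uminus: "x \<in> pS \<Longrightarrow> - x \<in> pS"
  using pS_mult[OF S_uminus[OF S_1], of x] by simp

lemma pS_diff: "x \<in> pS \<Longrightarrow> y \<in> pS \<Longrightarrow> x - y \<in> pS"
  using pS_add[OF _ pS_uminus, of x y] by simp

lemma pS_sum: "(\<And>i. i \<in> I \<Longrightarrow> f i \<in> pS) \<Longrightarrow> sum f I \<in> pS"
  by (induction I rule: infinite_finite_induct) (auto simp: pS_0 pS_add)

lemma p_pos: "p > 0" using p prime_gt_0_nat by auto

text \<open>Independence over Z/p of the residues in S / p S, phrased with integer
  coefficients.\<close>

definition p_indep :: "complex set \<Rightarrow> bool" where
  "p_indep A \<longleftrightarrow> finite A \<and> A \<subseteq> S \<and>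
    (\<forall>a :: complex \<Rightarrow> int. (\<Sum>x\<in>A. of_int (a x) * x) \<in> pS \<longrightarrow> (\<forall>x\<in>A. int p dvd a x))"

text \<open>An integral relation among elements independent modulo \<open>p\<close> would be divisible by every
  power of \<open>p\<close>; so the rank bounds the dimension of \<open>S / p S\<close>.\<close>

lemma p_indep_imp_independent:
  assumes "p_indep A" shows "QV.independent A"
proof
  have A: "finite A" "A \<subseteq> S" using assms by (auto simp: p_indep_def)
  assume "QV.dependent A"
  then obtain u where u: "(\<Sum>x\<in>A. of_rat (u x) * x) = 0" and nz: "\<exists>x\<in>A. u x \<noteq> 0"
    using QV.dependent_finite[OF A(1)] by auto
  define d where "d = (\<Prod>x\<in>A. snd (quotient_of (u x)))"
  have den: "snd (quotient_of r) \<noteq> 0" for r using quotient_of_denom_pos'[of r] by simp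
  have d0: "d \<noteq> 0" unfolding d_def using A(1) by (simp add: den)
  have "\<exists>a::int. of_int d * u x = of_int a" if x: "x \<in> A" for x
  proof -
    have "snd (quotient_of (u x)) dvd d" unfolding d_def using x A(1) by auto
    then obtain k where k: "d = snd (quotient_of (u x)) * k" by auto
    have "u x = of_int (fst (quotient_of (u x))) / of_int (snd (quotient_of (u x)))"
      using quotient_of_div by (metis prod.collapse)
    moreover note den[of "u x"]
    ultimately have "of_int d * u x = of_int (fst (quotient_of (u x)) * k)"
      by (simp add: k field_simps)
    then show ?thesis by blast
  qed
  then obtain a :: "complex \<Rightarrow> int" where a: "\<And>x. x \<in> A \<Longrightarrow> of_int d * u x = of_int (a x)"
    by metis
  have ac: "of_int (a x) = (of_int d * of_rat (u x) :: complex)" if "x \<in> A" for x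
    using a[OF that, THEN arg_cong, of "of_rat :: rat \<Rightarrow> complex"] by (simp add: of_rat_mult)
  have "(\<Sum>x\<in>A. of_int (a x) * x) = of_int d * (\<Sum>x\<in>A. of_rat (u x) * x)"
    by (simp add: sum_distrib_left ac mult.assoc)
  then have rel: "(\<Sum>x\<in>A. of_int (a x) * x) = 0" using u by simp
  have dvd: "\<forall>x\<in>A. int p ^ k dvd a x" for k
  proof (induction k)
    case (Suc k)
    then obtain b where b: "\<And>x. x \<in> A \<Longrightarrow> a x = int p ^ k * b x" unfolding dvd_def by metis
    have "(\<Sum>x\<in>A. of_int (a x) * x) = of_nat p ^ k * (\<Sum>x\<in>A. of_int (b x) * x)"
      by (simp add: sum_distrib_left b mult.assoc)
    then have "(\<Sum>x\<in>A. of_int (b x) * x) \<in> pS" using rel p_pos pS_0 by simp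
    then have "\<forall>x\<in>A. int p dvd b x" using assms unfolding p_indep_def by blast
    then show ?case by (simp add: b mult_dvd_mono mult.commute)
  qed auto
  have "a x = 0" if "x \<in> A" for x
  proof (rule ccontr)
    assume "a x \<noteq> 0"
    have "1 < int p" using p prime_gt_1_nat by auto
    then have "\<bar>a x\<bar> < int p ^ nat \<bar>a x\<bar>"
      using of_nat_less_two_power[of "nat \<bar>a x\<bar>", where 'a=int] power_mono[of 2 "int p" "nat \<bar>a x\<bar>"] by auto
    then show False using dvd that \<open>a x \<noteq> 0\<close> by (meson dvd_imp_le_int not_le abs_ge_self order_trans) 
  qed
  then have "u x = 0" if "x \<in> A" for x using a[OF that] that d0 by simp
  then show False using nz by blast
qed

text \<open>The rank bounds the size of independent families, so a largest one exists. By maximality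
  its residues span S / p S, and coefficients between 0 and p - 1 already reach every class.\<close>

lemma finite_residues: "\<exists>T. finite T \<and> T \<subseteq> S \<and> (\<forall>x\<in>S. \<exists>t\<in>T. x - t \<in> pS)"
proof -
  obtain B where B: "finite B" "S \<subseteq> QV.span B" using S_rank by auto
  have bound: "card A \<le> card B" if "p_indep A" for A
    using QV.independent_span_bound[OF B(1) p_indep_imp_independent[OF that]] that B(2)
    unfolding p_indep_def by auto
  have "p_indep {}" by (simp add: p_indep_def)
  then obtain A where A: "p_indep A" "\<And>A'. p_indep A' \<Longrightarrow> card A' \<le> card A"
    using ex_has_greatest_nat[of p_indep "{}" card "Suc (card B)"] bound by (auto simp: less_Suc_eq_le)
  have fin: "finite A" and AS: "A \<subseteq> S" using A(1) by (auto simp: p_indep_def)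
  define T where "T = (\<lambda>c. \<Sum>z\<in>A. of_int (c z) * z) ` (A \<rightarrow>\<^sub>E {0..<int p})"
  have "finite T" unfolding T_def using fin by (intro finite_imageI finite_PiE) auto
  moreover have "T \<subseteq> S" unfolding T_def using AS by (auto intro!: S_sum S_mult S_of_int)
  moreover have "\<exists>t\<in>T. x - t \<in> pS" if x: "x \<in> S" for x
  proof -
    have "\<exists>a :: complex \<Rightarrow> int. x - (\<Sum>z\<in>A. of_int (a z) * z) \<in> pS"
    proof (cases "x \<in> A")
      case True
      have "(\<Sum>z\<in>A. of_int (if z = x then 1 else 0) * z) = (\<Sum>z\<in>A. if z = x then x else 0)"
        by (intro sum.cong) auto
      also have "\<dots> = x" using True fin by simp
      finally show ?thesis using pS_0 by (intro exI[of _ "\<lambda>z. if z = x then 1 else 0"]) simp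
    next
      case False
      then have "\<not> p_indep (insert x A)" using A(2)[of "insert x A"] fin by auto
      then obtain a where a: "(\<Sum>z\<in>insert x A. of_int (a z) * z) \<in> pS" "\<not> (\<forall>z\<in>insert x A. int p dvd a z)"
        using fin AS x unfolding p_indep_def by auto
      let ?s = "\<Sum>z\<in>A. of_int (a z) * z"
      have rel: "of_int (a x) * x + ?s \<in> pS" using a(1) fin False by simp
      have "\<not> int p dvd a x"
      proof
        assume d: "int p dvd a x"
        then obtain k where "a x = int p * k" by auto
        then have "of_int (a x) * x = of_nat p * (of_int k * x)" by simp
        then have "of_int (a x) * x \<in> pS" using x by (simp only:) (intro pS_I S_mult S_of_int)
        then have "?s \<in> pS" using pS_diff[OF rel, of "of_int (a x) * x"] by simp
        then show False using A(1) a(2) d unfolding p_indep_def by blast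
      qed
      then have "coprime (int p) (a x)" using p by (intro prime_imp_coprime) auto
      \<comment> \<open>The coefficient of x in the relation is invertible modulo p, with inverse w,
        so the relation can be solved for x; this explains the coefficients
        \<open>- w * a z\<close>.\<close>
      then obtain u w where uw: "u * int p + w * a x = 1"
        using bezout_int[of "int p" "a x"] by auto
      have eq: "x - (\<Sum>z\<in>A. of_int (- w * a z) * z) = of_nat p * (of_int u * x) + of_int w * (of_int (a x) * x + ?s)"
      proof -
        have "x = of_int (u * int p + w * a x) * x" using uw by simp
        then have "x = of_nat p * (of_int u * x) + of_int w * (of_int (a x) * x)"
          by (simp add: algebra_simps)
        moreover have "(\<Sum>z\<in>A. of_int (- w * a z) * z) = - (of_int w * ?s)"
          by (simp add: sum_distrib_left sum_negf mult.assoc)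
        ultimately show ?thesis by (simp add: algebra_simps)
      qed
      show ?thesis
        using pS_add[OF pS_I[OF S_mult[OF S_of_int x]] pS_mult[OF S_of_int rel], of u w]
        unfolding eq[symmetric] by (rule exI[of _ "\<lambda>z. - w * a z"])
    qed
    then obtain a :: "complex \<Rightarrow> int" where a: "x - (\<Sum>z\<in>A. of_int (a z) * z) \<in> pS" by blast
    define c where "c = (\<lambda>z\<in>A. a z mod int p)"
    have "(\<Sum>z\<in>A. of_int (a z) * z) - (\<Sum>z\<in>A. of_int (c z) * z) = (\<Sum>z\<in>A. of_nat p * (of_int (a z div int p) * z))"
      unfolding sum_subtractf[symmetric]
    proof (intro sum.cong refl)
      fix z assume "z \<in> A"
      have "a z = int p * (a z div int p) + a z mod int p" by simp
      then have "(of_int (a z) :: complex) = of_nat p * of_int (a z div int p) + of_int (a z mod int p)"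
        by (metis of_int_add of_int_mult of_int_of_nat_eq)
      then show "of_int (a z) * z - of_int (c z) * z = of_nat p * (of_int (a z div int p) * z)"
        using \<open>z \<in> A\<close> by (simp add: c_def algebra_simps)
    qed
    also have "\<dots> \<in> pS" using AS by (intro pS_sum pS_I S_mult S_of_int) auto
    finally have "(x - (\<Sum>z\<in>A. of_int (a z) * z)) + ((\<Sum>z\<in>A. of_int (a z) * z) - (\<Sum>z\<in>A. of_int (c z) * z)) \<in> pS"
      using a by (intro pS_add)
    then have "x - (\<Sum>z\<in>A. of_int (c z) * z) \<in> pS" by simp
    moreover have "c \<in> A \<rightarrow>\<^sub>E {0..<int p}" using p_pos by (auto simp: c_def)
    ultimately show ?thesis unfolding T_def by blast
  qed
  ultimately show ?thesis by blast
qed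

lemma residue_pigeonhole:
  assumes "\<And>n::nat. f n \<in> S" shows "\<exists>i j. i < j \<and> f j - f i \<in> pS"
proof -
  obtain T where T: "finite T" "\<And>x. x \<in> S \<Longrightarrow> \<exists>t\<in>T. x - t \<in> pS" using finite_residues by blast
  have "\<forall>n. \<exists>t. t \<in> T \<and> f n - t \<in> pS" using T(2) assms by blast
  then obtain g where g: "\<And>n. g n \<in> T" "\<And>n. f n - g n \<in> pS" by metis
  have "\<not> inj g"
  proof
    assume "inj g"
    then have "finite (UNIV :: nat set)" using finite_imageD[of g UNIV] finite_subset[OF _ T(1), of "range g"] g(1) by auto
    then show False by simp
  qed
  then obtain i j where ij: "i \<noteq> j" "g i = g j" by (auto simp: inj_def)
  have *: "f j - f i \<in> pS" if "g i = g j" for i j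
    using pS_diff[OF g(2)[of j] g(2)[of i]] that by simp
  show ?thesis
  proof (cases "i < j")
    case True then show ?thesis using * ij by blast
  next
    case False then have "j < i" using ij by simp
    then show ?thesis using *[of j i] ij by auto
  qed
qed

text \<open>Two powers of x agree modulo p S. It is used in two ways: for x outside \<open>P\<close>
  it puts 1 - x^c into \<open>P\<close> and makes x invertible modulo \<open>P\<close>; for x in
  \<open>P\<close> it has 1 - x^c outside \<open>P\<close> and makes x nilpotent in the localization
  of S / p S.\<close>

lemma power_relation:
  assumes "x \<in> S" shows "\<exists>a c. c > 0 \<and> x ^ a * (1 - x ^ c) \<in> pS"
proof -
  obtain i j where ij: "i < j" "x ^ j - x ^ i \<in> pS"
    using residue_pigeonhole[of "\<lambda>n. x ^ n"] S_power[OF assms] by blast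
  have "x ^ i * (1 - x ^ (j - i)) = - (x ^ j - x ^ i)"
    using ij(1) by (simp add: algebra_simps flip: power_add)
  then show ?thesis using pS_uminus[OF ij(2)] ij(1) by (metis zero_less_diff)
qed

section \<open>Existence of a uniformizer at P\<close>

lemma inverse_mod_P:
  assumes "x \<in> S - P" shows "\<exists>u\<in>S. 1 - x * u \<in> P"
proof -
  obtain a c where ac: "c > 0" "x ^ a * (1 - x ^ c) \<in> pS" using power_relation[of x] assms by blast
  have "1 - x ^ c \<in> P"
    using P_prime[of "x ^ a" "1 - x ^ c"] ac pS_P notP_power[OF assms, of a] assms
    by (auto intro!: S_diff S_1 S_power)
  moreover have "x ^ c = x * x ^ (c - 1)" using ac(1) by (cases c) auto
  ultimately show ?thesis using S_power[of x "c - 1"] assms by auto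
qed

text \<open>Reduces the condition b P \<subseteq> p S to finitely many elements of
  \<open>P\<close>.\<close>

lemma P_finite_mod_p: "\<exists>A. finite A \<and> A \<subseteq> P \<and> (\<forall>x\<in>P. \<exists>y\<in>A. x - y \<in> pS)"
proof -
  obtain T where T: "finite T" "\<And>x. x \<in> S \<Longrightarrow> \<exists>t\<in>T. x - t \<in> pS" using finite_residues by blast
  define g where "g = (\<lambda>t. SOME x. x \<in> P \<and> x - t \<in> pS)"
  define A where "A = g ` {t \<in> T. \<exists>x\<in>P. x - t \<in> pS}"
  have g: "g t \<in> P \<and> g t - t \<in> pS" if "\<exists>x\<in>P. x - t \<in> pS" for t
    unfolding g_def using that by (intro someI_ex[of "\<lambda>x. x \<in> P \<and> x - t \<in> pS"]) blast
  have "\<exists>y\<in>A. x - y \<in> pS" if x: "x \<in> P" for x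
  proof -
    obtain t where t: "t \<in> T" "x - t \<in> pS" using T(2) x P_S by blast
    then have "(x - t) - (g t - t) \<in> pS" using g[of t] x pS_diff by blast
    then show ?thesis using t x by (intro bexI[of _ "g t"]) (auto simp: A_def)
  qed
  moreover have "finite A" "A \<subseteq> P" using T(1) g by (auto simp: A_def)
  ultimately show ?thesis by blast
qed

text \<open>The first condition on \<open>b\<close> says that its image in \<open>S / p S\<close> does not vanish in the
  localization at \<open>P\<close>.\<close>

lemma annihilator_finite:
  assumes "finite A" "A \<subseteq> P"
  shows "\<exists>b\<in>S. (\<forall>u\<in>S. u * b \<in> pS \<longrightarrow> u \<in> P) \<and> (\<forall>x\<in>A. b * x \<in> pS)"
  using assms
proof (induction A rule: finite_induct)
  case empty
  then show ?case using S_1 pS_P by (intro bexI[of _ 1]) auto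
next
  case (insert x A)
  then obtain b where b: "b \<in> S" "\<And>u. u \<in> S \<Longrightarrow> u * b \<in> pS \<Longrightarrow> u \<in> P" "\<And>x. x \<in> A \<Longrightarrow> b * x \<in> pS"
    by auto
  have x: "x \<in> P" "x \<in> S" using insert.prems P_S by auto
  \<comment> \<open>\<open>Q e\<close> says that b x^e vanishes in the localization of S / p S. It
    holds for some exponent because x is nilpotent there, and fails for 0 by the choice of b. At the
    last exponent before vanishing the element still survives but is killed by x; the factor u
    outside \<open>P\<close> moves this product into p S itself.\<close>
  define Q where "Q = (\<lambda>e. \<exists>u\<in>S - P. u * (b * x ^ e) \<in> pS)"
  obtain a c where ac: "c > 0" "x ^ a * (1 - x ^ c) \<in> pS" using power_relation x by blast
  have "1 - x ^ c \<notin> P"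
    using P_add[OF _ P_power[OF x(1) ac(1)], of "1 - x ^ c"] P_1 by auto
  moreover have "(1 - x ^ c) * (b * x ^ a) \<in> pS"
    using pS_mult[OF b(1) ac(2)] by (simp add: algebra_simps)
  ultimately have "Q a" using S_diff[OF S_1 S_power[OF x(2), of c]] unfolding Q_def by blast
  define e where "e = (LEAST e. Q e)"
  have e: "Q e" "\<And>k. k < e \<Longrightarrow> \<not> Q k"
    unfolding e_def using \<open>Q a\<close> by (auto intro: LeastI dest: not_less_Least)
  have "\<not> Q 0" using b(2) by (auto simp: Q_def)
  then obtain e' where e': "e = Suc e'" using e(1) by (cases e) auto
  obtain u where u: "u \<in> S - P" "u * (b * x ^ e) \<in> pS" using e(1) by (auto simp: Q_def)
  have nQ: "w \<in> P" if "w \<in> S" "w * (b * x ^ e') \<in> pS" for w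
    using e(2)[of e'] e' that by (auto simp: Q_def)
  define b' where "b' = u * (b * x ^ e')"
  have "b' \<in> S" using u b(1) x by (auto simp: b'_def intro!: S_mult S_power)
  moreover have "w \<in> P" if w: "w \<in> S" "w * b' \<in> pS" for w
  proof -
    have "w * u \<in> P" using w u S_mult by (intro nQ) (auto simp: b'_def mult.assoc)
    then show ?thesis using P_prime[of w u] w u by auto
  qed
  moreover have "b' * y \<in> pS" if "y \<in> insert x A" for y
  proof (cases "y = x")
    case True
    then show ?thesis using u(2) by (simp add: b'_def e' algebra_simps)
  next
    case False
    then have "(u * x ^ e') * (b * y) \<in> pS" using b(3)[of y] that u x by (intro pS_mult[of "u * x ^ e'"] S_mult S_power) auto
    then show ?thesis by (simp add: b'_def algebra_simps)
  qed
  ultimately show ?case by blast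
qed

text \<open>Invertibility of \<open>P\<close>: if \<open>y = b / p\<close> with \<open>b P \<subseteq> p S\<close> mapped \<open>P\<close> into itself, the powers
  \<open>p y\<^sup>n\<close> would all lie in \<open>S\<close>, two of them would agree modulo \<open>p S\<close>, and \<open>y\<close> would be integral.\<close>

lemma ex_uniformizer:
  assumes closed: "\<And>b. b \<in> S \<Longrightarrow> algebraic_int (b / of_nat p) \<Longrightarrow> b / of_nat p \<in> S"
  shows "\<exists>s \<pi>. s \<in> S - P \<and> \<pi> \<in> P \<and> (\<forall>x\<in>P. \<exists>y\<in>S. s * x = \<pi> * y)"
proof -
  have p0: "(of_nat p :: complex) \<noteq> 0" using p_pos by simp
  obtain A where A: "finite A" "A \<subseteq> P" "\<And>x. x \<in> P \<Longrightarrow> \<exists>y\<in>A. x - y \<in> pS"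
    using P_finite_mod_p by blast
  obtain b where b: "b \<in> S" "\<And>u. u \<in> S \<Longrightarrow> u * b \<in> pS \<Longrightarrow> u \<in> P" "\<And>x. x \<in> A \<Longrightarrow> b * x \<in> pS"
    using annihilator_finite[OF A(1,2)] by blast
  define y where "y = b / of_nat p"
  have b_eq: "b = of_nat p * y" using p0 by (simp add: y_def)
  have "b \<notin> pS" using b(2)[OF S_1] P_1 by auto
  then have yS: "y \<notin> S" using pS_I by (auto simp: b_eq)
  have yP: "y * x \<in> S" if x: "x \<in> P" for x
  proof -
    obtain x' where x': "x' \<in> A" "x - x' \<in> pS" using A(3)[OF x] by blast
    have "b * (x - x') + b * x' \<in> pS"
      using pS_add[OF pS_mult[OF b(1) x'(2)] b(3)[OF x'(1)]] .
    then have "b * x \<in> pS" by (simp add: algebra_simps)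
    then show ?thesis using p0 by (auto simp: b_eq pS_def)
  qed
  have "\<exists>\<pi>\<in>P. y * \<pi> \<notin> P"
  proof (rule ccontr)
    assume "\<not> ?thesis"
    then have st: "y * x \<in> P" if "x \<in> P" for x using that by blast
    have yn: "y ^ n * of_nat p \<in> P" for n
      by (induction n) (auto simp: p_P mult.assoc intro: st)
    obtain i j where ij: "i < j" "y ^ j * of_nat p - y ^ i * of_nat p \<in> pS"
      using residue_pigeonhole[of "\<lambda>n. y ^ n * of_nat p"] yn P_S by blast
    then obtain z where z: "z \<in> S" "y ^ j * of_nat p - y ^ i * of_nat p = of_nat p * z"
      by (auto elim: pS_E)
    then have "of_nat p * (y ^ j - y ^ i) = of_nat p * z" by (simp add: algebra_simps)
    then have yz: "y ^ j - y ^ i = z" using p0 by simp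
    \<comment> \<open>\<open>f\<close> is X^j - X^i, monic as i < j. Its value at y is the integral
      element z, which makes y integral.\<close>
    define f :: "complex poly" where "f = Polynomial.monom 1 j - Polynomial.monom 1 i"
    have cf: "Polynomial.coeff f k = (if k = j then 1 else 0) - (if k = i then 1 else 0)" for k
      by (auto simp: f_def)
    have degf: "Polynomial.degree f = j"
      using ij(1) by (intro antisym Polynomial.degree_le le_degree) (auto simp: cf)
    have "algebraic_int y"
    proof (rule algebraic_int_root[OF S_integral[OF z(1)]])
      show "poly f y = z" using yz by (simp add: f_def poly_monom)
      show "\<forall>k. Polynomial.coeff f k \<in> \<int>" by (auto simp: cf)
      show "Polynomial.lead_coeff f = 1" using ij(1) by (simp add: degf cf)
      show "Polynomial.degree f > 0" using ij(1) degf by simp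
    qed
    then show False using closed[OF b(1)] yS by (simp add: y_def)
  qed
  then obtain \<pi> where \<pi>: "\<pi> \<in> P" "y * \<pi> \<notin> P" by blast
  \<comment> \<open>The element s is y \<pi>, which lies in S but outside \<open>P\<close>; then s x
    = \<pi> (y x) with y x in S.\<close>
  have "\<exists>z\<in>S. (y * \<pi>) * x = \<pi> * z" if "x \<in> P" for x
    using yP[OF that] by (intro bexI[of _ "y * x"]) (auto simp: algebra_simps)
  then show ?thesis using yP[OF \<pi>(1)] \<pi> by blast
qed

text \<open>Strip the factors X from a monic integer polynomial with root x; the remaining constant
  term is a nonzero multiple of x.\<close>

lemma divides_int:
  assumes x: "x \<in> S" "x \<noteq> 0"
  shows "\<exists>g\<in>S. \<exists>m::int. m \<noteq> 0 \<and> x * g = of_int m"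
proof -
  have polyS: "poly (map_poly of_int f) x \<in> S" for f :: "int poly"
    by (induction f) (auto simp: map_poly_pCons S_0 intro!: S_add S_mult S_of_int x)
  obtain f where f: "poly (map_poly of_int f) x = 0" "Polynomial.lead_coeff f = (1 :: int)"
    using S_integral[OF x(1)] unfolding algebraic_int_altdef_ipoly by blast
  then have "f \<noteq> 0" by auto
  then have "\<exists>a r. a \<noteq> (0::int) \<and> poly (map_poly of_int (pCons a r)) x = 0" using f(1)
  proof (induction f)
    case (pCons a r)
    show ?case
    proof (cases "a = 0")
      case True
      then have "r \<noteq> 0" "poly (map_poly of_int r) x = 0" using pCons.prems x(2) by (auto simp: map_poly_pCons)
      then show ?thesis using pCons.IH by blast
    qed (use pCons.prems in blast)
  qed simp
  then obtain a r where ar: "a \<noteq> (0::int)" "of_int a + x * poly (map_poly of_int r) x = 0"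
    by (auto simp: map_poly_pCons)
  have "x * (- poly (map_poly of_int r) x) = of_int a" using ar(2) by (simp add: add_eq_0_iff)
  then show ?thesis using ar(1) S_uminus[OF polyS[of r]] by blast
qed

lemma of_int_notP: assumes "\<not> int p dvd m" shows "of_int m \<in> S - P"
proof -
  have "coprime (int p) m" using assms p by (intro prime_imp_coprime) auto
  then obtain u w where "u * int p + w * m = 1" using bezout_int[of "int p" m] by auto
  from this[THEN arg_cong, of of_int] have "of_int u * of_nat p + of_int w * of_int m = (1::complex)"
    by simp
  then have "of_int m \<notin> P"
    using P_1 P_add[OF P_mult[OF S_of_int p_P] P_mult[OF S_of_int], of m u w] by auto
  then show ?thesis using S_of_int by blast
qed

end

text \<open>As s is a unit at \<open>P\<close>, the condition says that \<pi> generates the maximal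
  ideal of the localization, stated without leaving S.\<close>

locale uniformized_order = prime_of_order +
  fixes s \<pi> :: complex
  assumes s: "s \<in> S - P" and \<pi>: "\<pi> \<in> P"
    and uniformizer: "x \<in> P \<Longrightarrow> \<exists>y\<in>S. s * x = \<pi> * y"
begin

abbreviation R where "R \<equiv> sub_CC S"

section \<open>Powers of P and the valuation they define\<close>

definition pw :: "nat \<Rightarrow> complex set" where "pw n = P [^]\<^bsub>ideals_set R\<^esub> n"

lemma pw_0: "pw 0 = S"
  by (simp add: pw_def ideals_set_def nat_pow_def)

lemma pw_Suc: "pw (Suc n) = ideal_prod R (pw n) P"
  by (simp add: pw_def ideals_set_def nat_pow_def)

lemma pw_Suc_prod: "x \<in> pw n \<Longrightarrow> y \<in> P \<Longrightarrow> x * y \<in> pw (Suc n)"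
  using ideal_prod.prod[of x "pw n" y P R] by (simp add: pw_Suc ring_of_type_algebra_def)

lemma pw_Suc_induct [consumes 1, case_names prod sum]:
  assumes "x \<in> pw (Suc n)"
    and "\<And>x y. x \<in> pw n \<Longrightarrow> y \<in> P \<Longrightarrow> Q (x * y)"
    and "\<And>x y. \<lbrakk>x \<in> pw (Suc n); y \<in> pw (Suc n); Q x; Q y\<rbrakk> \<Longrightarrow> Q (x + y)"
  shows "Q x"
  using assms(1) unfolding pw_Suc
proof (induction rule: ideal_prod.induct)
  case (prod i j) then show ?case using assms(2) by (simp add: ring_of_type_algebra_def)
next
  case (sum a b) then show ?case using assms(3) by (simp add: ring_of_type_algebra_def pw_Suc)
qed

lemma pw_add: assumes "x \<in> pw n" "y \<in> pw n" shows "x + y \<in> pw n"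
proof (cases n)
  case 0 then show ?thesis using assms S_add by (simp add: pw_0)
next
  case (Suc m)
  then show ?thesis using assms ideal_prod.sum[of x R "pw m" P y]
    by (simp add: pw_Suc ring_of_type_algebra_def)
qed

lemma pw_S: "pw n \<subseteq> S"
proof (induction n)
  case (Suc n)
  have "x \<in> S" if "x \<in> pw (Suc n)" for x
    using that by (induction rule: pw_Suc_induct) (use Suc P_S in \<open>auto intro: S_mult S_add\<close>)
  then show ?case by blast
qed (simp add: pw_0)

lemma pw_mult: "a \<in> S \<Longrightarrow> x \<in> pw n \<Longrightarrow> a * x \<in> pw n"
proof (induction n arbitrary: x)
  case (Suc n)
  from Suc.prems(2) show ?case
  proof (induction rule: pw_Suc_induct)
    case (prod x y)
    then show ?case using Suc.IH[of x] Suc.prems(1) pw_Suc_prod[of "a * x" n y] by (simp add: mult.assoc)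
  next
    case (sum x y) then show ?case by (simp add: distrib_left pw_add)
  qed
qed (simp add: pw_0 S_mult)

lemma pw_uminus: "x \<in> pw n \<Longrightarrow> - x \<in> pw n"
  using pw_mult[OF S_uminus[OF S_1], of x n] by simp

lemma pw_decseq_Suc: "pw (Suc n) \<subseteq> pw n"
proof
  fix x assume "x \<in> pw (Suc n)"
  then show "x \<in> pw n"
  proof (induction rule: pw_Suc_induct)
    case (prod x y) then show ?case using pw_mult[of y x n] P_S by (auto simp: mult.commute)
  qed (rule pw_add)
qed

lemma pw_decseq: "m \<le> n \<Longrightarrow> pw n \<subseteq> pw m"
  by (rule lift_Suc_antimono_le[of pw, OF pw_decseq_Suc])

lemma \<pi>_S: "\<pi> \<in> S" using \<pi> P_S by auto

lemma \<pi>_nz: "\<pi> \<noteq> 0"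
proof
  assume "\<pi> = 0"
  then have "s * of_nat p = 0" using uniformizer[OF p_P] by auto
  then show False using s P_0 p_pos by auto
qed

lemma \<pi>_power_pw: "\<pi> ^ n \<in> pw n"
proof (induction n)
  case (Suc n)
  show ?case using pw_Suc_prod[OF Suc \<pi>] by (simp add: mult.commute)
qed (simp add: pw_0 S_1)

text \<open>Powers of \<open>P\<close> are recognized in the localization. Forwards, s^n clears n
  factors from \<open>P\<close> at once. Backwards, t must be cancelled, which works because t is
  invertible modulo \<open>P\<close>.\<close>

lemma pw_iff: "x \<in> pw n \<longleftrightarrow> x \<in> S \<and> (\<exists>t\<in>S - P. \<exists>y\<in>S. t * x = \<pi> ^ n * y)"
proof
  have "\<exists>y\<in>S. s ^ n * x = \<pi> ^ n * y" if "x \<in> pw n" for x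
    using that
  proof (induction n arbitrary: x)
    case 0 then show ?case by (simp add: pw_0)
  next
    case (Suc n)
    from Suc.prems show ?case
    proof (induction rule: pw_Suc_induct)
      case (prod x y)
      obtain a b where "a \<in> S" "s ^ n * x = \<pi> ^ n * a" "b \<in> S" "s * y = \<pi> * b"
        using Suc.IH[OF prod(1)] uniformizer[OF prod(2)] by blast
      moreover have "s ^ Suc n * (x * y) = (s ^ n * x) * (s * y)" by (simp add: algebra_simps)
      ultimately have "s ^ Suc n * (x * y) = \<pi> ^ Suc n * (a * b)" by (simp add: algebra_simps)
      then show ?case using S_mult \<open>a \<in> S\<close> \<open>b \<in> S\<close> by blast
    next
      case (sum x y)
      then obtain a b where "a \<in> S" "b \<in> S" "s ^ Suc n * x = \<pi> ^ Suc n * a" "s ^ Suc n * y = \<pi> ^ Suc n * b" by blast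
      then show ?case by (intro bexI[of _ "a + b"]) (simp_all only: distrib_left S_add)
    qed
  qed
  then show "x \<in> S \<and> (\<exists>t\<in>S - P. \<exists>y\<in>S. t * x = \<pi> ^ n * y)" if "x \<in> pw n"
    using that pw_S notP_power[OF s, of n] by blast
next
  assume "x \<in> S \<and> (\<exists>t\<in>S - P. \<exists>y\<in>S. t * x = \<pi> ^ n * y)"
  then obtain t y where x: "x \<in> S" and t: "t \<in> S - P" and y: "y \<in> S" "t * x = \<pi> ^ n * y" by auto
  have tx: "t * x \<in> pw n" unfolding y(2) using pw_mult[OF y(1) \<pi>_power_pw] by (simp add: mult.commute)
  obtain u where u: "u \<in> S" "1 - t * u \<in> P" using inverse_mod_P[OF t] by blast
  \<comment> \<open>Use x = x (1 - t u) + u (t x): the first summand gains one power of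
    \<open>P\<close> over x, and the second lies in \<open>pw n\<close> anyway.\<close>
  have "x \<in> pw k" if "k \<le> n" for k
    using that
  proof (induction k)
    case (Suc k)
    have "x * (1 - t * u) \<in> pw (Suc k)" using Suc u by (intro pw_Suc_prod) auto
    moreover have "u * (t * x) \<in> pw (Suc k)"
      using pw_mult[OF u(1) tx] pw_decseq[OF Suc.prems] by blast
    ultimately have "x * (1 - t * u) + u * (t * x) \<in> pw (Suc k)" by (rule pw_add)
    then show ?case by (simp add: algebra_simps)
  qed (simp add: x pw_0)
  then show "x \<in> pw n" by simp
qed

text \<open>In the localization, x is \<pi>^n times a unit. In this form additivity of the order is
  immediate, while \<open>has_ord_iff\<close> ties it to the powers of \<open>P\<close>.\<close>

definition has_ord :: "complex \<Rightarrow> nat \<Rightarrow> bool" where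
  "has_ord x n \<longleftrightarrow> x \<in> S \<and> (\<exists>t\<in>S - P. \<exists>y\<in>S - P. t * x = \<pi> ^ n * y)"

lemma has_ord_iff: "has_ord x n \<longleftrightarrow> x \<in> pw n \<and> x \<notin> pw (Suc n)"
proof
  assume "has_ord x n"
  then obtain t y where x: "x \<in> S" and t: "t \<in> S - P" and y: "y \<in> S - P" "t * x = \<pi> ^ n * y"
    by (auto simp: has_ord_def)
  have "x \<notin> pw (Suc n)"
  proof
    assume "x \<in> pw (Suc n)"
    then obtain t' y' where *: "t' \<in> S - P" "y' \<in> S" "t' * x = \<pi> ^ Suc n * y'" unfolding pw_iff by blast
    have "\<pi> ^ n * (t' * y) = t' * (t * x)" using y(2) by (simp add: algebra_simps)
    also have "\<dots> = \<pi> ^ n * (\<pi> * (t * y'))" using *(3) by (simp add: algebra_simps)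
    finally have "t' * y = \<pi> * (t * y')" using \<pi>_nz by simp
    then have "t' * y \<in> P" using P_mult2[OF \<pi>, of "t * y'"] t *(2) S_mult by auto
    then show False using notP_mult[OF *(1) y(1)] by simp
  qed
  then show "x \<in> pw n \<and> x \<notin> pw (Suc n)" using x t y unfolding pw_iff[of x n] by blast
next
  assume *: "x \<in> pw n \<and> x \<notin> pw (Suc n)"
  then obtain t y where x: "x \<in> S" and t: "t \<in> S - P" and y: "y \<in> S" "t * x = \<pi> ^ n * y"
    unfolding pw_iff[of x n] by blast
  have "y \<notin> P"
  proof
    assume "y \<in> P"
    then obtain z where z: "z \<in> S" "s * y = \<pi> * z" using uniformizer by blast
    have "(s * t) * x = \<pi> ^ n * (s * y)" using y(2) by (simp add: algebra_simps)
    then have "(s * t) * x = \<pi> ^ Suc n * z" using z(2) by (simp add: algebra_simps)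
    then have "x \<in> pw (Suc n)" using x z(1) notP_mult[OF s t] unfolding pw_iff by blast
    then show False using * by simp
  qed
  then show "has_ord x n" using x t y unfolding has_ord_def by blast
qed

lemma has_ord_mult: assumes "has_ord x m" "has_ord y n" shows "has_ord (x * y) (m + n)"
proof -
  obtain t a u b where "t \<in> S - P" "a \<in> S - P" "t * x = \<pi> ^ m * a" "u \<in> S - P" "b \<in> S - P" "u * y = \<pi> ^ n * b"
    and S: "x \<in> S" "y \<in> S"
    using assms unfolding has_ord_def by blast
  moreover have "(t * u) * (x * y) = (t * x) * (u * y)" by simp
  ultimately have "(t * u) * (x * y) = \<pi> ^ (m + n) * (a * b)" "t * u \<in> S - P" "a * b \<in> S - P"
    by (auto simp: power_add notP_mult simp del: Diff_iff)
  then show ?thesis using S S_mult unfolding has_ord_def by blast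
qed

lemma has_ord_0: "x \<in> S - P \<Longrightarrow> has_ord x 0"
  using S_1 P_1 by (auto simp: has_ord_def intro!: bexI[of _ 1])

lemma has_ord_\<pi>_power: "has_ord (\<pi> ^ n) n"
  using S_1 P_1 S_power[OF \<pi>_S] by (auto simp: has_ord_def intro!: bexI[of _ 1])

lemma has_ord_if_notin: assumes "x \<in> S" "x \<notin> pw N" shows "\<exists>n. has_ord x n"
proof -
  define n where "n = (LEAST n. x \<notin> pw n)"
  have n: "x \<notin> pw n" "\<And>k. k < n \<Longrightarrow> x \<in> pw k"
    unfolding n_def using LeastI[of "\<lambda>n. x \<notin> pw n", OF assms(2)] by (auto dest: not_less_Least)
  then obtain k where "n = Suc k" using assms(1) by (cases n) (auto simp: pw_0)
  then show ?thesis using n by (auto simp: has_ord_iff intro: exI[of _ k])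
qed

text \<open>Two powers of \<pi> agree modulo p, say \<pi>^j - \<pi>^i = p z with i < j. If p lay in
  \<open>pw (Suc i)\<close>, so would \<pi>^i, which has order i. This starts the proof that no
  nonzero element lies in all powers of \<open>P\<close>.\<close>

lemma ex_ord_p: "\<exists>n. has_ord (of_nat p) n"
proof -
  obtain i j where ij: "i < j" "\<pi> ^ j - \<pi> ^ i \<in> pS"
    using residue_pigeonhole[of "\<lambda>n. \<pi> ^ n"] S_power[OF \<pi>_S] by blast
  then obtain z where z: "z \<in> S" "\<pi> ^ j - \<pi> ^ i = of_nat p * z" by (auto elim: pS_E)
  have "of_nat p \<notin> pw (Suc i)"
  proof
    assume "of_nat p \<in> pw (Suc i)"
    then have "- (z * of_nat p) \<in> pw (Suc i)" using z(1) by (intro pw_uminus pw_mult)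
    moreover have "\<pi> ^ j \<in> pw (Suc i)" using \<pi>_power_pw[of j] pw_decseq[of "Suc i" j] ij(1) by auto
    ultimately have "\<pi> ^ j + - (z * of_nat p) \<in> pw (Suc i)" by (intro pw_add)
    then have "\<pi> ^ i \<in> pw (Suc i)" using z(2) by (simp add: algebra_simps)
    then show False using has_ord_\<pi>_power[of i] by (simp add: has_ord_iff)
  qed
  then show ?thesis using S_of_nat has_ord_if_notin by blast
qed

lemma ex_ord_of_int: assumes "m \<noteq> 0" shows "\<exists>n. has_ord (of_int m) n"
proof -
  have "m \<noteq> 0 \<Longrightarrow> \<exists>n. has_ord (of_int m) n" for m
  proof (induction "nat \<bar>m\<bar>" arbitrary: m rule: less_induct)
    case less
    show ?case
    proof (cases "int p dvd m")
      case True
      then obtain k where k: "m = int p * k" by auto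
      have "int p > 1" using p prime_gt_1_nat by auto
      then have "k \<noteq> 0" "nat \<bar>k\<bar> < nat \<bar>m\<bar>" using less.prems by (auto simp: k abs_mult)
      then obtain n where "has_ord (of_int k) n" using less.hyps by blast
      then show ?thesis using ex_ord_p has_ord_mult unfolding k by fastforce
    next
      case False
      then show ?thesis using has_ord_0[OF of_int_notP] by blast
    qed
  qed
  then show ?thesis using assms by blast
qed

text \<open>A nonzero x divides a nonzero integer, and a divisor cannot lie in a higher power of
  \<open>P\<close> than its multiple.\<close>

lemma ex_ord: assumes "x \<in> S" "x \<noteq> 0" shows "\<exists>n. has_ord x n"
proof -
  obtain g m where g: "g \<in> S" "m \<noteq> 0" "x * g = of_int m" using divides_int[OF assms] by blast
  obtain n where "has_ord (of_int m) n" using ex_ord_of_int[OF g(2)] by blast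
  then have "x * g \<notin> pw (Suc n)" by (simp add: g(3) has_ord_iff)
  then have "x \<notin> pw (Suc n)" using pw_mult[OF g(1), of x "Suc n"] by (auto simp: mult.commute)
  then show ?thesis using has_ord_if_notin assms(1) by blast
qed

lemma pw_iff_le: assumes "has_ord x n" shows "x \<in> pw k \<longleftrightarrow> k \<le> n"
proof
  assume "k \<le> n" then show "x \<in> pw k" using assms pw_decseq by (auto simp: has_ord_iff)
next
  assume "x \<in> pw k"
  then show "k \<le> n" using assms pw_decseq[of "Suc n" k] by (cases "k \<le> n") (auto simp: has_ord_iff)
qed

lemma adic_ord_eq: assumes "has_ord x n" shows "adic_ord R P x = n"
  unfolding adic_ord_def pw_def[symmetric]
  using pw_iff_le[OF assms] by (intro Greatest_equality) auto

abbreviation ord where "ord \<equiv> adic_ord R P"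

lemma has_ord_ord: "x \<in> S \<Longrightarrow> x \<noteq> 0 \<Longrightarrow> has_ord x (ord x)"
  using ex_ord adic_ord_eq by auto

lemma ord_mult: "\<lbrakk>x \<in> S; y \<in> S; x \<noteq> 0; y \<noteq> 0\<rbrakk> \<Longrightarrow> ord (x * y) = ord x + ord y"
  using has_ord_mult[OF has_ord_ord has_ord_ord] adic_ord_eq by blast

lemma ord_notP: "x \<in> S - P \<Longrightarrow> ord x = 0"
  using has_ord_0 adic_ord_eq by blast

lemma ord_P_pos: assumes "x \<in> P" "x \<noteq> 0" shows "ord x > 0"
proof -
  have x: "x \<in> S" using assms P_S by auto
  have "x \<in> pw 1" using pw_Suc_prod[of 1 0 x] assms S_1 by (simp add: pw_0)
  then show ?thesis using pw_iff_le[OF has_ord_ord[OF x assms(2)], of 1] by simp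
qed

lemma adic_val_divide:
  assumes "a \<in> S" "b \<in> S" "a \<noteq> 0" "b \<noteq> 0"
  shows "adic_val R P (a / b) = int (ord a) - int (ord b)"
  unfolding adic_val_def
proof (rule the_equality)
  show "\<exists>a' \<in> carrier R - {0}. \<exists>b' \<in> carrier R - {0}. a / b = a' / b' \<and>
      int (ord a) - int (ord b) = int (ord a') - int (ord b')"
    using assms by auto
  fix k assume "\<exists>a' \<in> carrier R - {0}. \<exists>b' \<in> carrier R - {0}. a / b = a' / b' \<and>
      k = int (ord a') - int (ord b')"
  then obtain a' b' where *: "a' \<in> S" "a' \<noteq> 0" "b' \<in> S" "b' \<noteq> 0" "a / b = a' / b'"
    "k = int (ord a') - int (ord b')" by auto
  then have "a * b' = a' * b" using assms by (simp add: field_simps)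
  then have "ord a + ord b' = ord a' + ord b" using ord_mult * assms by metis
  then show "k = int (ord a) - int (ord b)" using *(6) by simp
qed

text \<open>Over a common denominator the ultrametric inequality becomes closure of
  \<open>pw n\<close> under addition. Truncation by \<open>nat\<close> is harmless since
  \<open>pw 0\<close> is all of S.\<close>

lemma adic_val_ge_divide_iff:
  assumes "a \<in> S" "b \<in> S" "b \<noteq> 0"
  shows "adic_val_ge R P (a / b) k \<longleftrightarrow> a \<in> pw (nat (k + int (ord b)))"
proof (cases "a = 0")
  case True
  have "0 \<in> pw n" for n using pw_mult[OF S_0 \<pi>_power_pw[of n]] by simp
  then show ?thesis using True by (simp add: adic_val_ge_def)
next
  case False
  then have "adic_val_ge R P (a / b) k \<longleftrightarrow> k + int (ord b) \<le> int (ord a)"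
    using assms by (auto simp: adic_val_ge_def adic_val_divide)
  also have "\<dots> \<longleftrightarrow> a \<in> pw (nat (k + int (ord b)))"
    unfolding pw_iff_le[OF has_ord_ord[OF assms(1) False]] by auto
  finally show ?thesis .
qed

lemma adic_valuedI:
  assumes "subfield K CC" and frac: "\<And>x. x \<in> K \<Longrightarrow> \<exists>a\<in>S. \<exists>b\<in>S. b \<noteq> 0 \<and> x = a / b"
  shows "adic_valued K R P"
proof -
  interpret CC: field CC by (rule field_from_type_algebra)
  note sr = subringE[OF subfieldE(1)[OF assms(1)], unfolded CC_simps]
  show ?thesis
  proof
    show "0 \<in> K" "1 \<in> K" by (fact sr)+
    show "x + y \<in> K" "x * y \<in> K" if "x \<in> K" "y \<in> K" for x y
      using sr(6,7)[OF that] by simp_all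
    show "- x \<in> K" if "x \<in> K" for x using sr(5)[OF that] .
    show "inverse x \<in> K" if "x \<in> K" for x
      using CC.subfield_m_inv(1)[OF assms(1), of x] that \<open>0 \<in> K\<close>
      by (cases "x = 0") (auto simp: CC_simps CC_inv)
  next
    fix x y assume *: "x \<in> K" "y \<in> K" "x \<noteq> 0" "y \<noteq> 0"
    obtain a b c d where ab: "a \<in> S" "b \<in> S" "b \<noteq> 0" "x = a / b" "c \<in> S" "d \<in> S" "d \<noteq> 0" "y = c / d"
      using frac *(1,2) by meson
    then have nz: "a \<noteq> 0" "c \<noteq> 0" using * by auto
    have "x * y = (a * c) / (b * d)" using ab by simp
    then show "adic_val R P (x * y) = adic_val R P x + adic_val R P y"
      using ab nz by (simp add: adic_val_divide S_mult ord_mult)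
  next
    fix x y k assume *: "x \<in> K" "y \<in> K" "adic_val_ge R P x k" "adic_val_ge R P y k"
    obtain a b c d where ab: "a \<in> S" "b \<in> S" "b \<noteq> 0" "x = a / b" "c \<in> S" "d \<in> S" "d \<noteq> 0" "y = c / d"
      using frac *(1,2) by meson
    have bd: "b * d \<in> S" "b * d \<noteq> 0" and ad: "a * d \<in> S" "c * b \<in> S" using ab S_mult by auto
    have xy: "x = (a * d) / (b * d)" "y = (c * b) / (b * d)" "x + y = (a * d + c * b) / (b * d)"
      using ab by (auto simp: field_simps)
    show "adic_val_ge R P (x + y) k"
      using * unfolding xy(3) unfolding xy(1,2)
        adic_val_ge_divide_iff[OF ad(1) bd] adic_val_ge_divide_iff[OF ad(2) bd]
        adic_val_ge_divide_iff[OF S_add[OF ad] bd]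
      by (intro pw_add)
  qed
qed

end

text \<open>The ramification index is the order of a uniformizer of the smaller order at the larger prime.\<close>

lemma adic_val_extension:
  assumes O1: "uniformized_order S P p s \<pi>" and O2: "uniformized_order S' P' p' s' \<pi>'"
    and S: "S \<subseteq> S'" "P' \<inter> S = P"
  obtains e :: int where "e > 0"
    "\<And>a b. \<lbrakk>a \<in> S; b \<in> S; a \<noteq> 0; b \<noteq> 0\<rbrakk> \<Longrightarrow>
      adic_val (sub_CC S') P' (a / b) = e * adic_val (sub_CC S) P (a / b)"
proof -
  interpret A: uniformized_order S P p s \<pi> by fact
  interpret B: uniformized_order S' P' p' s' \<pi>' by fact
  have \<pi>P': "\<pi> \<in> P'" "\<pi> \<in> S'" using A.\<pi> S A.\<pi>_S by auto
  have pow: "B.ord (\<pi> ^ n) = n * B.ord \<pi>" for n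
  proof (induction n)
    case 0 show ?case using B.ord_notP[of 1] B.S_1 B.P_1 by simp
  next
    case (Suc n)
    show ?case using Suc B.ord_mult[OF \<pi>P'(2) B.S_power[OF \<pi>P'(2), of n]] A.\<pi>_nz by simp
  qed
  have ord: "B.ord a = A.ord a * B.ord \<pi>" if a: "a \<in> S" "a \<noteq> 0" for a
  proof -
    \<comment> \<open>As P' meets S in P, the units t and y at P are units at P' too, so only the
      power of \<pi> contributes.\<close>
    obtain t y where t: "t \<in> S - P" "y \<in> S - P" "t * a = \<pi> ^ A.ord a * y"
      using A.has_ord_ord[OF a] unfolding A.has_ord_def by blast
    have t': "t \<in> S' - P'" "y \<in> S' - P'" using t S by auto
    have nz: "t \<noteq> 0" "y \<noteq> 0" using t A.P_0 by auto
    have "B.ord t + B.ord a = B.ord (\<pi> ^ A.ord a) + B.ord y"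
      using t t' nz a S(1) B.ord_mult[of t a] B.ord_mult[of "\<pi> ^ A.ord a" y] B.S_power[OF \<pi>P'(2)] A.\<pi>_nz
      by auto
    then show ?thesis using B.ord_notP t' by (simp add: pow)
  qed
  show thesis
  proof
    show "int (B.ord \<pi>) > 0" using B.ord_P_pos[OF \<pi>P'(1) A.\<pi>_nz] by simp
    fix a b assume ab: "a \<in> S" "b \<in> S" "a \<noteq> 0" "b \<noteq> 0"
    then have "a \<in> S'" "b \<in> S'" using S by auto
    then show "adic_val (sub_CC S') P' (a / b) = int (B.ord \<pi>) * adic_val (sub_CC S) P (a / b)"
      using ab by (simp add: A.adic_val_divide B.adic_val_divide ord algebra_simps)
  qed
qed

section \<open>Completion of a radical extension\<close>

context adic_valued
begin

abbreviation const where "const x \<equiv> cls (\<lambda>_. x)"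

lemma const_closed: "x \<in> K \<Longrightarrow> const x \<in> carrier E"
  by (simp add: cls_closed C_const)

lemma const_mult: "x \<in> K \<Longrightarrow> y \<in> K \<Longrightarrow> const x \<otimes>\<^bsub>E\<^esub> const y = const (x * y)"
  by (simp add: cls_mult C_const)

lemma const_power: assumes "x \<in> K" shows "const x [^]\<^bsub>E\<^esub> (n::nat) = const (x ^ n)"
proof -
  have pw: "x ^ n \<in> K" for n using assms K_1 K_mult by (induction n) auto
  show ?thesis
  proof (induction n)
    case (Suc n) then show ?case using const_mult[OF pw[of n] assms] by (simp add: mult.commute)
  qed (simp add: cls_one)
qed

lemma const_eq_iff: assumes "x \<in> K" "y \<in> K" shows "const x = const y \<longleftrightarrow> x = y"
proof
  assume "const x = const y"
  then have "(\<lambda>_. x - y) \<in> N" using assms by (simp add: cls_eq_iff C_const)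
  then have "\<exists>M::nat. \<forall>n\<ge>M. ge (x - y) k" for k unfolding mem_N by blast
  then have "ge (x - y) (v (x - y) + 1)" by blast
  then show "x = y" by (simp add: adic_val_ge_def)
qed simp

lemma const_inverse: assumes "x \<in> K" "x \<noteq> 0" shows "inv\<^bsub>E\<^esub> (const x) = const (inverse x)"
  using assms by (intro E.comm_inv_char) (auto simp: const_closed const_mult K_inverse cls_one)

text \<open>The elements whose constant class lies in \<open>F\<close> form a subfield, so it
  suffices to test generators.\<close>

lemma const_mem_if_generated:
  assumes G: "H \<subseteq> K" "K = generate_field CC H"
    and F: "subfield F E" and H: "\<And>h. h \<in> H \<Longrightarrow> const h \<in> F" and x: "x \<in> K"
  shows "const x \<in> F"
proof -
  note sr = subringE[OF subfieldE(1)[OF F]]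
  have F_inv: "inv\<^bsub>E\<^esub> y \<in> F" if "y \<in> F" "y \<noteq> \<zero>\<^bsub>E\<^esub>" for y
    using E.subfield_m_inv(1)[OF F] that by auto
  have "x \<in> generate_field CC H" using x G by simp
  \<comment> \<open>Membership in \<open>K\<close> is carried along because \<open>const\<close> is
    known to respect the operations only there.\<close>
  then have "x \<in> K \<and> const x \<in> F"
  proof (induction rule: generate_field.induct)
    case one then show ?case using sr K_1 by (simp add: CC_simps cls_one)
  next
    case (incl h) then show ?case using G H by auto
  next
    case (a_inv h)
    then show ?case using sr(5)[of "const h"] by (simp add: CC_simps K_uminus cls_uminus C_const)
  next
    case (m_inv h)
    then have "h \<noteq> 0" by (simp add: CC_simps)
    moreover have "const h \<noteq> \<zero>\<^bsub>E\<^esub>" using const_eq_iff[of h 0] m_inv \<open>h \<noteq> 0\<close> K_0 by (simp add: cls_zero)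
    ultimately show ?case using m_inv F_inv[of "const h"] by (simp add: CC_inv K_inverse const_inverse)
  next
    case (eng_add a b)
    then show ?case using sr(7)[of "const a" "const b"] by (simp add: CC_simps K_add cls_add C_const)
  next
    case (eng_mult a b)
    then show ?case using sr(6)[of "const a" "const b"] by (simp add: CC_simps K_mult const_mult)
  qed
  then show ?thesis by simp
qed

end

context adic_extension
begin

lemma completion_embed_const:
  "x \<in> K \<Longrightarrow> completion_embed L S Q (to_completion K R P x) = l.const x"
  by (simp add: to_completion_def completion_embed_cls k.C_const)

lemma const_F: "x \<in> K \<Longrightarrow> l.const x \<in> F"
  using k.C_const by (auto simp: F_eq)

text \<open>The field obtained by adjoining the image of \<beta> to \<open>F\<close> contains the
  images of all generators of \<open>L\<close>, hence of \<open>L\<close> itself, which is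
  dense.\<close>

lemma completion_eq_simple_extension:
  assumes L: "L = generate_field CC (insert \<beta> K)" and \<beta>: "(l.E.algebraic over F) (l.const \<beta>)"
  shows "l.E.simple_extension F (l.const \<beta>) = carrier l.E"
proof (rule lE.dense_simple_extension_eq_carrier[OF subfield_F vcomplete_F _ \<beta>])
  have "\<beta> \<in> L" unfolding L by (intro generate_field.incl) simp
  then show \<beta>E: "l.const \<beta> \<in> carrier l.E" by (rule l.const_closed)
  let ?G = "l.E.simple_extension F (l.const \<beta>)"
  have G: "subfield ?G l.E"
    using lE.simple_extension_is_subfield[OF subfield_F \<beta>E] \<beta> by simp
  have "l.const h \<in> ?G" if "h \<in> insert \<beta> K" for h
    using that l.E.simple_extension_mem[OF subfieldE(1)[OF subfield_F] \<beta>E]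
      l.E.simple_extension_incl[OF subfieldE(3)[OF subfield_F] \<beta>E] const_F by auto
  then have const_G: "l.const x \<in> ?G" if "x \<in> L" for x
    using l.const_mem_if_generated[OF _ L G _ that] K_L \<open>\<beta> \<in> L\<close> by blast
  fix A k assume "A \<in> carrier l.E"
  then obtain t where t: "t \<in> carrier l.C" "A = l.cls t" by (rule l.E_cases)
  then obtain M where "l.vg (A \<ominus>\<^bsub>l.E\<^esub> l.const (t M)) k" using l.const_dense by blast
  then show "\<exists>w\<in>?G. l.vg (A \<ominus>\<^bsub>l.E\<^esub> w) k" using const_G[OF l.C_K[OF t(1)]] by blast
qed

theorem power_mem_norm_group:
  assumes L: "L = generate_field CC (insert \<beta> K)" and \<beta>: "\<beta> ^ q \<in> K" "\<beta> \<noteq> 0"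
    and q: "Factorial_Ring.prime q" and \<xi>: "\<xi> \<in> K" "primitive_root_of_unity q \<xi>"
    and x: "x \<in> K" "x \<noteq> 0"
  shows "completion_embed L S Q (to_completion K R P (x ^ (q * m))) \<in>
    field_norm l.E (completion_embed L S Q ` carrier k.E) ` (carrier l.E - {\<zero>\<^bsub>l.E\<^esub>})"
proof -
  have \<beta>L: "\<beta> \<in> L" unfolding L by (intro generate_field.incl) simp
  have \<xi>L: "\<xi> \<in> L" using \<xi> K_L by auto
  let ?b = "l.const \<beta>" and ?z = "l.const \<xi>"
  have bE: "?b \<in> carrier l.E" using \<beta>L by (rule l.const_closed)
  have bq: "?b [^]\<^bsub>l.E\<^esub> q \<in> F" using l.const_power[OF \<beta>L] const_F[OF \<beta>(1)] by simp
  have b0: "?b \<noteq> \<zero>\<^bsub>l.E\<^esub>" using l.const_eq_iff[OF \<beta>L l.K_0] \<beta>(2) by (simp add: l.cls_zero)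
  have z: "?z \<in> F" "?z [^]\<^bsub>l.E\<^esub> q = \<one>\<^bsub>l.E\<^esub>"
    using const_F[OF \<xi>(1)] l.const_power[OF \<xi>L] \<xi>(2) by (simp_all add: primitive_root_of_unity_def l.cls_one)
  have zk: "?z [^]\<^bsub>l.E\<^esub> k \<noteq> \<one>\<^bsub>l.E\<^esub>" if "0 < k" "k < q" for k
  proof -
    have "\<xi> ^ k \<in> L" using \<xi>L l.K_1 l.K_mult by (induction k) auto
    then show ?thesis
      using l.const_power[OF \<xi>L, of k] l.const_eq_iff[OF _ l.K_1, of "\<xi> ^ k"] \<xi>(2) that
      by (simp add: primitive_root_of_unity_def l.cls_one)
  qed
  have alg: "(l.E.algebraic over F) ?b"
    using lE.algebraic_if_pow_mem[OF subfield_F bE bq] q prime_gt_0_nat by simp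
  define d where "d = Polynomials.degree (l.E.Irr F ?b)"
  have d: "d = 1 \<or> d = q"
    unfolding d_def using lE.degree_Irr_Kummer[OF subfield_F bE b0 bq q z zk] by simp
  have dim: "l.E.dimension d F (carrier l.E)"
    using lE.dimension_simple_extension[OF subfield_F bE alg] completion_eq_simple_extension[OF L alg]
    by (simp add: d_def)
  \<comment> \<open>n is q m for d = 1 and m for d = q.\<close>
  obtain n where n: "n * d = q * m"
    using d by (metis mult.commute mult.right_neutral)
  have xK: "x ^ i \<in> K" for i using x k.K_1 k.K_mult by (induction i) auto
  then have xn: "x ^ n \<in> K" .
  then have xnL: "x ^ n \<in> L" using K_L by auto
  have xqm: "x ^ (q * m) \<in> K" using xK .
  have "field_norm l.E F (l.const (x ^ n)) = l.const (x ^ n) [^]\<^bsub>l.E\<^esub> d"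
    by (rule lE.field_norm_base[OF subfield_F dim const_F[OF xn]])
  also have "\<dots> = l.const (x ^ (q * m))"
    using l.const_power[OF xnL] n by (simp flip: power_mult)
  also have "\<dots> = completion_embed L S Q (to_completion K R P (x ^ (q * m)))"
    using completion_embed_const[OF xqm] by simp
  finally have "field_norm l.E F (l.const (x ^ n)) = \<dots>" .
  moreover have "l.const (x ^ n) \<in> carrier l.E - {\<zero>\<^bsub>l.E\<^esub>}"
    using l.const_closed[OF xnL] l.const_eq_iff[OF xnL l.K_0] x(2) by (simp add: l.cls_zero)
  ultimately show ?thesis unfolding F_def[symmetric] by (metis image_eqI)
qed

end

section \<open>Cyclotomic fields, their radical extensions and the final assembly\<close>

lemma subfield_rat: "subfield (range of_rat) CC"
proof -
  interpret CC: field CC by (rule field_from_type_algebra)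
  show ?thesis
  proof (rule CC.subfieldI')
    show "subring (range of_rat) CC"
      by (rule CC.subringI)
        (auto simp: CC_simps simp flip: of_rat_add of_rat_mult of_rat_minus intro: range_eqI[of _ of_rat 1, simplified])
    fix k :: complex assume "k \<in> range of_rat - {\<zero>\<^bsub>CC\<^esub>}"
    then show "inv\<^bsub>CC\<^esub> k \<in> range of_rat" by (auto simp: CC_simps CC_inv simp flip: of_rat_inverse)
  qed
qed

lemma finite_dimension_rat_subset_span:
  assumes "ring.finite_dimension CC (range of_rat) V"
  shows "\<exists>B. finite B \<and> V \<subseteq> QV.span B"
proof -
  interpret CC: field CC by (rule field_from_type_algebra)
  obtain Vs where "CC.Span (range of_rat) Vs = V"
    using assms CC.exists_base[OF subfield_rat] unfolding CC.finite_dimension_def by blast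
  moreover have "CC.Span (range of_rat) Vs \<subseteq> QV.span (set Vs)" for Vs
  proof (induction Vs)
    case (Cons u Us)
    show ?case
    proof
      fix x assume "x \<in> CC.Span (range of_rat) (u # Us)"
      then obtain r w where "w \<in> CC.Span (range of_rat) Us" "x = of_rat r * u + w"
        by (auto simp: CC.line_extension_mem_iff CC_simps)
      moreover have "w \<in> QV.span (set (u # Us))"
        using Cons calculation(1) QV.span_mono[of "set Us" "set (u # Us)"] by auto
      moreover have "of_rat r * u \<in> QV.span (set (u # Us))"
        by (intro QV.span_scale QV.span_base) simp
      ultimately show "x \<in> QV.span (set (u # Us))" using QV.span_add by simp
    qed
  qed (simp add: CC_simps QV.span_zero)
  ultimately show ?thesis by blast
qed

lemma generate_field_subset_fractions:
  assumes S: "1 \<in> S" "\<And>x. x \<in> S \<Longrightarrow> - x \<in> S"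
      "\<And>x y. x \<in> S \<Longrightarrow> y \<in> S \<Longrightarrow> x + y \<in> S" "\<And>x y. x \<in> S \<Longrightarrow> y \<in> S \<Longrightarrow> x * y \<in> S"
    and H: "\<And>h. h \<in> H \<Longrightarrow> \<exists>a\<in>S. \<exists>b\<in>S. b \<noteq> 0 \<and> h = a / b"
    and x: "x \<in> generate_field CC H"
  shows "\<exists>a\<in>S. \<exists>b\<in>S. b \<noteq> 0 \<and> x = a / (b :: complex)"
  using x
proof (induction rule: generate_field.induct)
  case one then show ?case using S(1) by (auto simp: CC_simps intro!: bexI[of _ 1])
next
  case (incl h) then show ?case using H by blast
next
  case (a_inv h)
  then obtain a b where "a \<in> S" "b \<in> S" "b \<noteq> 0" "h = a / b" by blast
  then have "- a \<in> S" "\<ominus>\<^bsub>CC\<^esub> h = - a / b" using S(2) by (simp_all add: CC_simps)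
  then show ?case using \<open>b \<in> S\<close> \<open>b \<noteq> 0\<close> by blast
next
  case (m_inv h)
  then obtain a b where "a \<in> S" "b \<in> S" "b \<noteq> 0" "h = a / b" "h \<noteq> 0" by (auto simp: CC_simps)
  then have "a \<noteq> 0" "inv\<^bsub>CC\<^esub> h = b / a" by (auto simp: CC_inv)
  then show ?case using \<open>a \<in> S\<close> \<open>b \<in> S\<close> by blast
next
  case (eng_add x y)
  then obtain a b c d where "a \<in> S" "b \<in> S" "b \<noteq> 0" "x = a / b" "c \<in> S" "d \<in> S" "d \<noteq> 0" "y = c / d" by blast
  then have "a * d + c * b \<in> S" "b * d \<in> S" "b * d \<noteq> 0" "x \<oplus>\<^bsub>CC\<^esub> y = (a * d + c * b) / (b * d)"
    using S by (simp_all add: CC_simps field_simps)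
  then show ?case by blast
next
  case (eng_mult x y)
  then obtain a b c d where "a \<in> S" "b \<in> S" "b \<noteq> 0" "x = a / b" "c \<in> S" "d \<in> S" "d \<noteq> 0" "y = c / d" by blast
  then have "a * c \<in> S" "b * d \<in> S" "b * d \<noteq> 0" "x \<otimes>\<^bsub>CC\<^esub> y = (a * c) / (b * d)"
    using S by (simp_all add: CC_simps)
  then show ?case by blast
qed

lemma algebraic_int_if_power:
  fixes x :: "'a :: field_char_0"
  assumes "algebraic_int (x ^ n)" "n > 0" shows "algebraic_int x"
proof (rule algebraic_int_root[OF assms(1)])
  show "poly (Polynomial.monom 1 n) x = x ^ n" by (simp add: poly_monom)
qed (use assms(2) in \<open>auto simp: Polynomial.degree_monom_eq\<close>)

text \<open>One storey of a radical tower over the rationals: a simple algebraic extension has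
  finite dimension, and finiteness passes up the tower. It is applied to \<xi> and then to
  \<beta>.\<close>

lemma finite_dimension_simple_radical:
  assumes F: "subfield F CC" "ring.finite_dimension CC (range of_rat) F" and x: "x ^ n \<in> F" "n > 0"
  obtains F' where "subfield F' CC" "ring.finite_dimension CC (range of_rat) F'" "F \<subseteq> F'" "x \<in> F'"
proof -
  interpret CC: field CC by (rule field_from_type_algebra)
  have xc: "x \<in> carrier CC" by (simp add: CC_simps)
  have alg: "(CC.algebraic over F) x"
    using CC.algebraic_if_pow_mem[OF F(1) xc _ x(2)] x(1) by (simp add: CC_pow)
  show thesis
  proof
    show F': "subfield (CC.simple_extension F x) CC"
      using CC.simple_extension_is_subfield[OF F(1) xc] alg by simp
    show "CC.finite_dimension (range of_rat) (CC.simple_extension F x)"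
      using CC.telescopic_base_dim(1)[OF subfield_rat F(1) F(2)]
        CC.finite_dimension_simple_extension[OF F(1) xc] alg by blast
    show "F \<subseteq> CC.simple_extension F x" using CC.simple_extension_incl[OF subfieldE(3)[OF F(1)] xc] .
    show "x \<in> CC.simple_extension F x" using CC.simple_extension_mem[OF subfieldE(1)[OF F(1)] xc] .
  qed
qed

lemma prime_of_orderI:
  assumes P: "primeideal P (sub_CC S)" and p: "Factorial_Ring.prime p" "of_nat p \<in> P"
    and S: "\<And>x. x \<in> S \<Longrightarrow> algebraic_int x" "\<exists>B. finite B \<and> S \<subseteq> QV.span B"
  shows "prime_of_order S P p"
proof -
  interpret P: primeideal P "sub_CC S" by fact
  \<comment> \<open>Negation in \<open>sub_CC S\<close> is formed relative to S; uniqueness of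
    additive inverses identifies it with complex negation.\<close>
  have S_uminus: "- x \<in> S" if x: "x \<in> S" for x
  proof -
    obtain y where "y \<in> S" "x + y = 0"
      using abelian_group.r_neg[OF P.is_abelian_group, of x] abelian_group.a_inv_closed[OF P.is_abelian_group, of x] x
      by (simp add: CC_simps)
    then show ?thesis by (metis add.inverse_unique)
  qed
  show ?thesis
  proof
    show "1 \<in> S" using P.one_closed by (simp add: CC_simps)
    show "x + y \<in> S" "x * y \<in> S" if "x \<in> S" "y \<in> S" for x y
      using P.add.m_closed[of x y] P.m_closed[of x y] that by (simp_all add: CC_simps)
    show "P \<subseteq> S" using P.a_subset by simp
    show "0 \<in> P" using additive_subgroup.zero_closed[OF P.additive_subgroup_axioms] by (simp add: CC_simps)
    show "x + y \<in> P" if "x \<in> P" "y \<in> P" for x y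
      using additive_subgroup.a_closed[OF P.additive_subgroup_axioms] that by (simp add: CC_simps)
    show "x * y \<in> P" if "x \<in> S" "y \<in> P" for x y using P.I_l_closed[of y x] that by (simp add: CC_simps)
    show "1 \<notin> P" using P.one_imp_carrier P.I_notcarr by (auto simp: CC_simps)
    show "x \<in> P \<or> y \<in> P" if "x \<in> S" "y \<in> S" "x * y \<in> P" for x y
      using P.I_prime[of x y] that by (simp add: CC_simps)
  qed (use p S S_uminus in auto)
qed
text \<open>Both \<xi> and \<beta> are radicals, so adjoining them in turn gives a finite
  dimensional field containing the one in question, which is enough to bound its rank.\<close>

lemma cyclotomic_tower:
  assumes \<xi>: "primitive_root_of_unity q \<xi>" and \<beta>: "\<beta> ^ q \<in> cyclotomic_field \<xi>"
  shows "subfield (adjoin (cyclotomic_field \<xi>) \<beta>) CC"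
    and "\<exists>B. finite B \<and> adjoin (cyclotomic_field \<xi>) \<beta> \<subseteq> QV.span B"
proof -
  interpret CC: field CC by (rule field_from_type_algebra)
  have q: "\<xi> ^ q = 1" "q > 0" using \<xi> by (auto simp: primitive_root_of_unity_def)
  show "subfield (adjoin (cyclotomic_field \<xi>) \<beta>) CC"
    unfolding adjoin_def by (rule CC.generate_field_is_subfield) (simp add: CC_simps)
  have "CC.finite_dimension (range of_rat) (range of_rat)"
    using CC.dimension_one[OF subfield_rat] CC.finite_dimensionI by blast
  moreover have "\<xi> ^ q \<in> range of_rat" using range_eqI[of 1 of_rat 1] q(1) by simp
  ultimately obtain K' where K': "subfield K' CC" "CC.finite_dimension (range of_rat) K'" "\<xi> \<in> K'"
    using finite_dimension_simple_radical[OF subfield_rat _ _ q(2), of \<xi>] by blast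
  have KK': "cyclotomic_field \<xi> \<subseteq> K'"
    unfolding cyclotomic_field_def using K' by (intro CC.generate_field_min_subfield1) (auto simp: CC_simps)
  then obtain L' where L': "subfield L' CC" "CC.finite_dimension (range of_rat) L'" "K' \<subseteq> L'" "\<beta> \<in> L'"
    using finite_dimension_simple_radical[OF K'(1,2) _ q(2), of \<beta>] \<beta> by blast
  have "adjoin (cyclotomic_field \<xi>) \<beta> \<subseteq> L'"
    unfolding adjoin_def using L' KK' by (intro CC.generate_field_min_subfield1) (auto simp: CC_simps)
  then show "\<exists>B. finite B \<and> adjoin (cyclotomic_field \<xi>) \<beta> \<subseteq> QV.span B"
    using finite_dimension_rat_subset_span[OF L'(2)] by (meson order_trans)
qed

lemma cyclotomic_ring_closed:
  "1 \<in> cyclotomic_ring \<xi>" "\<xi> \<in> cyclotomic_ring \<xi>"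
  "x \<in> cyclotomic_ring \<xi> \<Longrightarrow> - x \<in> cyclotomic_ring \<xi>"
  "x \<in> cyclotomic_ring \<xi> \<Longrightarrow> y \<in> cyclotomic_ring \<xi> \<Longrightarrow> x + y \<in> cyclotomic_ring \<xi>"
  "x \<in> cyclotomic_ring \<xi> \<Longrightarrow> y \<in> cyclotomic_ring \<xi> \<Longrightarrow> x * y \<in> cyclotomic_ring \<xi>"
  unfolding cyclotomic_ring_def
  using generate_ring.one[of CC "{\<xi>}"] generate_ring.incl[of \<xi> "{\<xi>}" CC]
    generate_ring.a_inv[of x CC "{\<xi>}"] generate_ring.eng_add[of x CC "{\<xi>}" y]
    generate_ring.eng_mult[of x CC "{\<xi>}" y]
  by (auto simp: CC_simps)

lemma cyclotomic_ring_subset: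
  assumes "\<xi> \<in> T" "1 \<in> T" "\<And>x. x \<in> T \<Longrightarrow> - x \<in> T" "\<And>x y. x \<in> T \<Longrightarrow> y \<in> T \<Longrightarrow> x + y \<in> T"
    "\<And>x y. x \<in> T \<Longrightarrow> y \<in> T \<Longrightarrow> x * y \<in> T"
  shows "cyclotomic_ring \<xi> \<subseteq> T"
proof
  fix x assume "x \<in> cyclotomic_ring \<xi>"
  then show "x \<in> T" unfolding cyclotomic_ring_def
    by (induction rule: generate_ring.induct) (use assms in \<open>auto simp: CC_simps\<close>)
qed

lemma cyclotomic_field_fractions:
  assumes "x \<in> cyclotomic_field \<xi>"
  shows "\<exists>a\<in>cyclotomic_ring \<xi>. \<exists>b\<in>cyclotomic_ring \<xi>. b \<noteq> 0 \<and> x = a / b"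
proof (rule generate_field_subset_fractions[where H = "{\<xi>}"])
  fix h assume "h \<in> {\<xi>}"
  then have "h = \<xi> / 1" by simp
  then show "\<exists>a\<in>cyclotomic_ring \<xi>. \<exists>b\<in>cyclotomic_ring \<xi>. b \<noteq> 0 \<and> h = a / b"
    using cyclotomic_ring_closed(1,2) one_neq_zero by blast
qed (use assms cyclotomic_ring_closed in \<open>auto simp: cyclotomic_field_def\<close>)

theorem proposition2p8:
  fixes p q l :: nat
    and \<xi> p1 \<alpha> \<beta> :: complex
    and K L P :: "complex set"
    and Z_xi O_L :: "complex ring"
    and K_p1 L_P :: "(nat \<Rightarrow> complex) set ring"
    and emb_K :: "complex \<Rightarrow> (nat \<Rightarrow> complex) set"
    and \<iota> :: "(nat \<Rightarrow> complex) set \<Rightarrow> (nat \<Rightarrow> complex) set"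
    and A :: "((nat \<Rightarrow> complex) set, (symbol_gen list \<Rightarrow> (nat \<Rightarrow> complex) set) set) module"
  assumes p: "Factorial_Ring.prime p"
    and q: "q \<in> {3, 5, 7, 11, 13, 17, 19}"
    and xi: "primitive_root_of_unity q \<xi>"
    and K: "K = cyclotomic_field \<xi>"
    and Z_xi: "Z_xi = sub_CC (cyclotomic_ring \<xi>)"
    and p1: "p1 \<in> carrier Z_xi" "ring_prime\<^bsub>Z_xi\<^esub> p1" "p1 divides\<^bsub>Z_xi\<^esub> (of_nat p)"
    and l: "l > 0"
    and alpha: "\<alpha> \<in> K" "\<alpha> \<noteq> 0"
    and K_p1: "K_p1 = completion K Z_xi (PIdl\<^bsub>Z_xi\<^esub> p1)"
    and emb_K: "emb_K = to_completion K Z_xi (PIdl\<^bsub>Z_xi\<^esub> p1)"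
    and A: "A = symbol_algebra K_p1 q (emb_K \<xi>) (emb_K \<alpha>) (emb_K (p1 ^ (q * l)))"
    and L: "\<beta> ^ q = \<alpha>" "L = adjoin K \<beta>"
    and O_L: "O_L = sub_CC (ring_of_integers L)"
    and P: "primeideal P O_L" "P \<inter> carrier Z_xi = PIdl\<^bsub>Z_xi\<^esub> p1"
    and L_P: "L_P = completion L O_L P"
    and iota: "\<iota> = completion_embed L O_L P"
  shows "\<iota> (emb_K (p1 ^ (q * l))) \<in>
           field_norm L_P (\<iota> ` carrier K_p1) ` (carrier L_P - {\<zero>\<^bsub>L_P\<^esub>})"
proof -
  define S where "S = cyclotomic_ring \<xi>"
  define D where "D = ring_of_integers L"
  interpret CC: field CC by (rule field_from_type_algebra)
  interpret P: primeideal P "sub_CC D" using P(1) by (simp add: O_L D_def)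
  have q_prime: "Factorial_Ring.prime q" using q by (elim insertE) simp_all
  have q0: "q > 0" using q_prime prime_gt_0_nat by blast
  have \<beta>K: "\<beta> ^ q \<in> K" using L alpha by simp
  have \<beta>0: "\<beta> \<noteq> 0" using L(1) alpha(2) q0 by auto
  have Lf: "subfield L CC" using cyclotomic_tower(1)[OF xi] \<beta>K by (simp add: L(2) K)
  have Kf: "subfield K CC"
    unfolding K cyclotomic_field_def by (rule CC.generate_field_is_subfield) (simp add: CC_simps)
  obtain B where B: "finite B" "L \<subseteq> QV.span B"
    using cyclotomic_tower(2)[OF xi] \<beta>K by (auto simp: L(2) K)
  have KL: "K \<subseteq> L" and \<beta>L: "\<beta> \<in> L" by (auto simp: L(2) adjoin_def intro: generate_field.incl)
  have \<xi>K: "\<xi> \<in> K" by (auto simp: K cyclotomic_field_def intro: generate_field.incl)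
  note Lr = subringE[OF subfieldE(1)[OF Lf], unfolded CC_simps]
  have O_L': "x \<in> D \<longleftrightarrow> x \<in> L \<and> algebraic_int x" for x by (auto simp: D_def ring_of_integers_def)
  have S_int: "algebraic_int \<xi>"
    using xi by (intro algebraic_int_if_power[of \<xi> q]) (auto simp: primitive_root_of_unity_def)
  \<comment> \<open>Closure under sums and products is contained in the hypothesis on
    \<open>P\<close>, since \<open>primeideal\<close> includes that the ambient structure is a
    commutative ring.\<close>
  have D_closed: "1 \<in> D" "- x \<in> D" "x + y \<in> D" "x * y \<in> D" if "x \<in> D" "y \<in> D" for x y
    using that P.one_closed P.add.m_closed[of x y] P.m_closed[of x y] Lr(5)[of x]
    by (auto simp: CC_simps O_L')
  have SO: "S \<subseteq> D"
    unfolding S_def using D_closed S_int \<xi>K KL P.one_closed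
    by (intro cyclotomic_ring_subset) (auto simp: CC_simps O_L')
  have SK: "S \<subseteq> K"
    unfolding S_def using subringE[OF subfieldE(1)[OF Kf], unfolded CC_simps] \<xi>K
    by (intro cyclotomic_ring_subset) auto
  have S_sub: "sub_CC S = Z_xi" by (simp add: S_def Z_xi)
  interpret Z: domain "sub_CC S"
  proof (rule CC.subring_is_domain)
    show "subring S CC" unfolding S_def cyclotomic_ring_def
      by (rule CC.generate_ring_is_subring) (simp add: CC_simps)
  qed
  define P0 where "P0 = PIdl\<^bsub>sub_CC S\<^esub> p1"
  have p1S: "p1 \<in> S" and p1_0: "p1 \<noteq> 0"
    using p1(1,2) by (auto simp: Z_xi S_def ring_prime_def CC_simps)
  have P0_prime: "primeideal P0 (sub_CC S)"
    unfolding P0_def using Z.primeideal_iff_prime[of p1] p1(2)[unfolded S_sub[symmetric]] p1S p1_0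
    by (simp add: CC_simps)
  have P0_iff: "x \<in> P0 \<longleftrightarrow> (\<exists>y\<in>S. x = y * p1)" for x
    by (auto simp: P0_def cgenideal_def CC_simps)
  have PP0: "P \<inter> S = P0" using P(2) by (simp add: P0_def flip: S_sub)
  have pP0: "of_nat p \<in> P0"
  proof -
    obtain c where "c \<in> S" "of_nat p = p1 * c"
      using p1(3) unfolding S_sub[symmetric] by (auto simp: factor_def CC_simps)
    then show ?thesis by (auto simp: P0_iff mult.commute)
  qed
  interpret A: prime_of_order S P0 p
  proof (rule prime_of_orderI[OF P0_prime p pP0])
    show "\<exists>B. finite B \<and> S \<subseteq> QV.span B" using B SO O_L' by (intro exI[of _ B]) auto
  qed (use SO O_L' in auto)
  \<comment> \<open>\<open>P0\<close> is principal, so its generator p1 is a uniformizer with s =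
    1.\<close>
  interpret A: uniformized_order S P0 p 1 p1
    using A.S_1 A.P_1 P0_iff by unfold_locales (auto simp: mult.commute intro!: bexI[of _ 1])
  interpret B: prime_of_order D P p
  proof (rule prime_of_orderI[OF P.primeideal_axioms p])
    show "\<exists>B. finite B \<and> D \<subseteq> QV.span B" using B O_L' by (intro exI[of _ B]) auto
  qed (use O_L' pP0 PP0 in auto)
  \<comment> \<open>The closure condition of \<open>ex_uniformizer\<close> holds because
    \<open>D\<close> consists of all algebraic integers in \<open>L\<close> and b / p stays in
    \<open>L\<close>.\<close>
  have "\<exists>s \<pi>. s \<in> D - P \<and> \<pi> \<in> P \<and> (\<forall>x\<in>P. \<exists>y\<in>D. s * x = \<pi> * y)"
  proof (rule B.ex_uniformizer)
    fix b assume b: "b \<in> D" "algebraic_int (b / of_nat p)"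
    have "of_nat p \<in> L" using B.S_of_nat[of p] by (simp add: O_L')
    moreover have "of_nat p \<noteq> (0::complex)" using B.p_pos by simp
    ultimately have "inverse (of_nat p) \<in> L"
      using CC.subfield_m_inv(1)[OF Lf, of "of_nat p"] by (simp add: CC_simps CC_inv)
    then show "b / of_nat p \<in> D" using b Lr(6)[of b "inverse (of_nat p)"] by (simp add: O_L' divide_inverse)
  qed
  then obtain s \<pi> where s\<pi>: "s \<in> D - P" "\<pi> \<in> P" "\<And>x. x \<in> P \<Longrightarrow> \<exists>y\<in>D. s * x = \<pi> * y" by blast
  interpret B: uniformized_order D P p s \<pi> using s\<pi> by unfold_locales
  have fracK: "\<exists>a\<in>S. \<exists>b\<in>S. b \<noteq> 0 \<and> x = a / b" if "x \<in> K" for x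
    using cyclotomic_field_fractions that by (simp add: K S_def)
  have fracL: "\<exists>a\<in>D. \<exists>b\<in>D. b \<noteq> 0 \<and> x = a / b" if "x \<in> L" for x
  proof (rule generate_field_subset_fractions)
    show "x \<in> generate_field CC (insert \<beta> K)" using that by (simp add: L(2) adjoin_def)
    fix h assume "h \<in> insert \<beta> K"
    then show "\<exists>a\<in>D. \<exists>b\<in>D. b \<noteq> 0 \<and> h = a / b"
    proof
      assume h: "h = \<beta>"
      \<comment> \<open>Clearing the denominator of \<alpha> = a / b makes \<beta> b integral,
        because its q-th power is a b^(q - 1). So \<beta> is a fraction of elements of
        \<open>D\<close>.\<close>
      obtain a b where ab: "a \<in> S" "b \<in> S" "b \<noteq> 0" "\<alpha> = a / b" using fracK[OF alpha(1)] by blast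
      have "b ^ q = b * b ^ (q - 1)" using q0 by (cases q) auto
      then have "(\<beta> * b) ^ q = a * b ^ (q - 1)" using ab by (simp add: power_mult_distrib L(1))
      moreover have "a * b ^ (q - 1) \<in> D" using ab SO by (intro B.S_mult B.S_power) auto
      ultimately have "algebraic_int ((\<beta> * b) ^ q)" by (simp only: O_L')
      then have "algebraic_int (\<beta> * b)" by (rule algebraic_int_if_power[OF _ q0])
      moreover have bD: "b \<in> D" using ab(2) SO by blast
      ultimately have "\<beta> * b \<in> D" using Lr(6)[OF \<beta>L, of b] by (simp add: O_L')
      moreover have "h = \<beta> * b / b" using h ab(3) by simp
      ultimately show ?thesis using ab(3) bD by blast
    next
      assume "h \<in> K" then show ?thesis using fracK SO by blast
    qed
  qed (auto intro: B.S_1 B.S_uminus B.S_add B.S_mult)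
  interpret k: adic_valued K "sub_CC S" P0 by (rule A.adic_valuedI[OF Kf fracK])
  interpret l: adic_valued L "sub_CC D" P by (rule B.adic_valuedI[OF Lf fracL])
  obtain e :: int where e: "e > 0" "\<And>a b. \<lbrakk>a \<in> S; b \<in> S; a \<noteq> 0; b \<noteq> 0\<rbrakk> \<Longrightarrow>
      adic_val (sub_CC D) P (a / b) = e * adic_val (sub_CC S) P0 (a / b)"
    using adic_val_extension[OF A.uniformized_order_axioms B.uniformized_order_axioms SO PP0] by metis
  interpret ext: adic_extension K "sub_CC S" P0 L "sub_CC D" P e
  proof
    show "adic_val (sub_CC D) P x = e * adic_val (sub_CC S) P0 x" if x: "x \<in> K" "x \<noteq> 0" for x
    proof -
      obtain a b where "a \<in> S" "b \<in> S" "b \<noteq> 0" "x = a / b" using fracK[OF x(1)] by blast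
      then show ?thesis using e(2)[of a b] x(2) by auto
    qed
  qed (use KL e in auto)
  have "completion_embed L (sub_CC D) P (to_completion K (sub_CC S) P0 (p1 ^ (q * l))) \<in>
    field_norm l.E (completion_embed L (sub_CC D) P ` carrier k.E) ` (carrier l.E - {\<zero>\<^bsub>l.E\<^esub>})"
    using L(2) p1S SK by (intro ext.power_mem_norm_group[OF _ \<beta>K \<beta>0 q_prime \<xi>K xi _ p1_0]) (auto simp: adjoin_def)
  then show ?thesis
    by (simp add: iota emb_K K_p1 L_P O_L D_def S_def P0_def Z_xi)
qed

end
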